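(* Let $N\in\mathbb{N}$, $p>1$, $b>0$, and let $G\in C^1(\mathbb{R})$ satisfy $G(0)=0$ and $G(\sigma)\ge b|\sigma|^p$ for all $\sigma\in\mathbb{R}$. Let $f,g\in C_c^\infty(\mathbb{R}^N)$ with $\int_{\mathbb{R}^N}g(x)\,dx>0$, and put $r_0=\sup\{|x|\;;\;x\in\operatorname{supp}(f,g)\}$. Assume $\Gamma_G(N,p)\ge0$. Then there exist constants $\varepsilon_0>0$ and $C>0$, independent of $\varepsilon$, such that the following holds for every $\varepsilon\in(0,\varepsilon_0]$: if $u$ is a weak solution in $(0,T)$ of $$\partial_t^2u-\Delta u=G(\partial_tu)\ \text{ in }\mathbb{R}^N\times(0,T),\qquad u(0)=\varepsilon f,\quad\partial_tu(0)=\varepsilon g,$$ satisfying $\operatorname{supp}u\subset\{(x,t)\in\mathbb{R}^N\times[0,T]\;;\;|x|\le r_0+t\}$, then $$T\le\begin{cases}C\varepsilon^{-\Gamma_G(N,p)^{-1}}&\text{if }1<p<p_G(N),\\ \exp(C\varepsilon^{-(p-1)})&\text{if }N\ge2,\ p=p_G(N).\end{cases}$$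
   Context: Set $\Gamma_G(N,p)=\frac{1}{p-1}-\frac{N-1}{2}$, $p_G(N)=\frac{N+1}{N-1}$ for $N\ge2$, and $p_G(1)=\infty$. Weak solution in $(0,T)$: a function $u\in C([0,T);H^1(\mathbb{R}^N))\cap C^1([0,T);L^2(\mathbb{R}^N))$ with $G(\partial_tu)\in L^1(0,T;L^1(\mathbb{R}^N))$, $u(0)=\varepsilon f$, $\partial_tu(0)=\varepsilon g$, such that for every $\Psi\in C_c^\infty(\mathbb{R}^N\times[0,T))$, $$\varepsilon\int_{\mathbb{R}^N}g(x)\Psi(x,0)\,dx+\int_0^T\!\!\int_{\mathbb{R}^N}G(\partial_tu)\Psi\,dx\,dt=\int_0^T\!\!\int_{\mathbb{R}^N}\big(-\partial_tu\,\partial_t\Psi+\nabla u\cdot\nabla\Psi\big)\,dx\,dt.$$ *)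

theory Defs
  imports "HOL-Analysis.Analysis"
begin

subsection \<open>Exponents\<close>

definition Gamma_G :: "nat \<Rightarrow> real \<Rightarrow> real" where
  "Gamma_G N p = 1 / (p - 1) - (real N - 1) / 2"

definition p_G :: "nat \<Rightarrow> ereal" where
  "p_G N = (if N = 1 then \<infinity> else ereal ((real N + 1) / (real N - 1)))"

subsection \<open>Smooth functions and test functions\<close>

primrec Ck :: "nat \<Rightarrow> ('a::euclidean_space \<Rightarrow> real) \<Rightarrow> bool" where
  "Ck 0 f \<longleftrightarrow> continuous_on UNIV f"
| "Ck (Suc k) f \<longleftrightarrow> (\<forall>x. f differentiable (at x)) \<and>
     (\<forall>v. Ck k (\<lambda>x. frechet_derivative f (at x) v))"

definition smooth :: "('a::euclidean_space \<Rightarrow> real) \<Rightarrow> bool" where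
  "smooth f \<longleftrightarrow> (\<forall>k. Ck k f)"

definition supp :: "('a::topological_space \<Rightarrow> 'b::zero) \<Rightarrow> 'a set" where
  "supp f = closure {x. f x \<noteq> 0}"

definition smooth_compact :: "('a::euclidean_space \<Rightarrow> real) \<Rightarrow> bool" where
  "smooth_compact f \<longleftrightarrow> smooth f \<and> compact (supp f)"

text \<open>Smoothness on the set \<open>UNIV \<times> {0..<T}\<close>, which is not open, means having a smooth
  extension; test functions are represented by such an extension to all of space-time. They need
  not vanish at time \<open>0\<close>, and only their values at times in \<open>{0..<T}\<close> matter.\<close>

definition test_function :: "real \<Rightarrow> ('a::euclidean_space \<times> real \<Rightarrow> real) \<Rightarrow> bool" where
  "test_function T \<psi> \<longleftrightarrow> smooth \<psi> \<and>
     (let K = closure {z \<in> UNIV \<times> {0..<T}. \<psi> z \<noteq> 0} in compact K \<and> K \<subseteq> UNIV \<times> {0..<T})"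

definition grad :: "('a::euclidean_space \<Rightarrow> real) \<Rightarrow> 'a \<Rightarrow> 'a" where
  "grad f x = (\<Sum>b\<in>Basis. frechet_derivative f (at x) b *\<^sub>R b)"

subsection \<open>Function spaces\<close>

text \<open>Elements of \<open>L\<^sup>2\<close> and \<open>H\<^sup>1\<close> are represented by functions; everything below depends only
  on their classes modulo equality almost everywhere. A map from a time interval into such a space
  is a function \<open>u\<close> such that \<open>u t\<close> represents its value at time \<open>t\<close>; joint measurability
  in \<open>(x, t)\<close> of the chosen representatives is not required.\<close>

definition L2 :: "('a::euclidean_space \<Rightarrow> 'b::euclidean_space) \<Rightarrow> bool" where
  "L2 f \<longleftrightarrow> f \<in> borel_measurable lebesgue \<and> integrable lebesgue (\<lambda>x. (norm (f x))\<^sup>2)"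

definition norm_L2 :: "('a::euclidean_space \<Rightarrow> 'b::euclidean_space) \<Rightarrow> real" where
  "norm_L2 f = sqrt (LINT x|lebesgue. (norm (f x))\<^sup>2)"

definition is_weak_grad :: "('a::euclidean_space \<Rightarrow> real) \<Rightarrow> ('a \<Rightarrow> 'a) \<Rightarrow> bool" where
  "is_weak_grad f w \<longleftrightarrow> L2 w \<and>
     (\<forall>\<phi>. smooth_compact \<phi> \<longrightarrow> (\<forall>b\<in>Basis.
        (LINT x|lebesgue. f x * frechet_derivative \<phi> (at x) b) =
        - (LINT x|lebesgue. (w x \<bullet> b) * \<phi> x)))"

definition H1 :: "('a::euclidean_space \<Rightarrow> real) \<Rightarrow> bool" where
  "H1 f \<longleftrightarrow> L2 f \<and> (\<exists>w. is_weak_grad f w)"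

definition weak_grad :: "('a::euclidean_space \<Rightarrow> real) \<Rightarrow> 'a \<Rightarrow> 'a" where
  "weak_grad f = (SOME w. is_weak_grad f w)"

definition norm_H1 :: "('a::euclidean_space \<Rightarrow> real) \<Rightarrow> real" where
  "norm_H1 f = sqrt ((norm_L2 f)\<^sup>2 + (norm_L2 (weak_grad f))\<^sup>2)"

definition continuous_into_H1 :: "real set \<Rightarrow> (real \<Rightarrow> 'a::euclidean_space \<Rightarrow> real) \<Rightarrow> bool" where
  "continuous_into_H1 I u \<longleftrightarrow> (\<forall>t\<in>I. H1 (u t)) \<and>
     (\<forall>t\<in>I. ((\<lambda>s. norm_H1 (\<lambda>x. u s x - u t x)) \<longlongrightarrow> 0) (at t within I))"

definition continuous_into_L2 :: "real set \<Rightarrow> (real \<Rightarrow> 'a::euclidean_space \<Rightarrow> real) \<Rightarrow> bool" where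
  "continuous_into_L2 I u \<longleftrightarrow> (\<forall>t\<in>I. L2 (u t)) \<and>
     (\<forall>t\<in>I. ((\<lambda>s. norm_L2 (\<lambda>x. u s x - u t x)) \<longlongrightarrow> 0) (at t within I))"

text \<open>\<open>u\<close> is continuously differentiable as an \<open>L\<^sup>2\<close>-valued map, with derivative \<open>v\<close>
  (one-sided at an end point belonging to \<open>I\<close>).\<close>

definition C1_into_L2_with_deriv ::
  "real set \<Rightarrow> (real \<Rightarrow> 'a::euclidean_space \<Rightarrow> real) \<Rightarrow> (real \<Rightarrow> 'a \<Rightarrow> real) \<Rightarrow> bool" where
  "C1_into_L2_with_deriv I u v \<longleftrightarrow> (\<forall>t\<in>I. L2 (u t)) \<and> continuous_into_L2 I v \<and>
     (\<forall>t\<in>I. ((\<lambda>s. norm_L2 (\<lambda>x. (u s x - u t x) / (s - t) - v t x)) \<longlongrightarrow> 0) (at t within I))"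

text \<open>Bochner (strong) measurability and Bochner integrability of an \<open>L\<^sup>1\<close>-valued map: the
  approximating \<open>s n\<close> are simple \<open>L\<^sup>1\<close>-valued functions of time.\<close>

definition strongly_measurable_L1 ::
  "real set \<Rightarrow> (real \<Rightarrow> 'a::euclidean_space \<Rightarrow> real) \<Rightarrow> bool" where
  "strongly_measurable_L1 I F \<longleftrightarrow>
     (AE t in lebesgue_on I. integrable lebesgue (F t)) \<and>
     (\<exists>s. (\<forall>n. finite (s n ` I) \<and> (\<forall>t\<in>I. integrable lebesgue (s n t)) \<and>
               (\<forall>h. {t\<in>I. s n t = h} \<in> sets lebesgue)) \<and>
          (AE t in lebesgue_on I. (\<lambda>n. LINT x|lebesgue. \<bar>s n t x - F t x\<bar>) \<longlonglongrightarrow> 0))"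

definition L1_L1 :: "real set \<Rightarrow> (real \<Rightarrow> 'a::euclidean_space \<Rightarrow> real) \<Rightarrow> bool" where
  "L1_L1 I F \<longleftrightarrow> strongly_measurable_L1 I F \<and>
     integrable (lebesgue_on I) (\<lambda>t. LINT x|lebesgue. \<bar>F t x\<bar>)"

text \<open>The (closed) support in \<open>UNIV \<times> {0..T}\<close> of a map \<open>u\<close> from \<open>{0..<T}\<close> into a space of
  classes of functions: the complement of the largest relatively open set on which \<open>u\<close>
  vanishes.\<close>

definition spacetime_supp :: "real \<Rightarrow> (real \<Rightarrow> 'a::euclidean_space \<Rightarrow> real) \<Rightarrow> ('a \<times> real) set" where
  "spacetime_supp T u = {z \<in> UNIV \<times> {0..T}.
     \<not> (\<exists>U. open U \<and> z \<in> U \<and>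
          (\<forall>t\<in>{0..<T}. AE x in lebesgue. (x, t) \<in> U \<longrightarrow> u t x = 0))}"

subsection \<open>Weak solutions\<close>

text \<open>Weak solutions in \<open>(0,T)\<close> of \<open>\<partial>\<^sub>t\<^sup>2 u - \<Delta>u = G(\<partial>\<^sub>t u)\<close> with initial data
  \<open>u(0) = \<epsilon>f\<close>, \<open>\<partial>\<^sub>t u(0) = \<epsilon>g\<close>. Here \<open>v\<close> is the time derivative of \<open>u\<close>; it is unique
  up to equality almost everywhere at each time.\<close>

definition weak_solution ::
  "(real \<Rightarrow> real) \<Rightarrow> ('a::euclidean_space \<Rightarrow> real) \<Rightarrow> ('a \<Rightarrow> real) \<Rightarrow> real \<Rightarrow> real
     \<Rightarrow> (real \<Rightarrow> 'a \<Rightarrow> real) \<Rightarrow> bool" where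
  "weak_solution G f g \<epsilon> T u \<longleftrightarrow> 0 < T \<and> continuous_into_H1 {0..<T} u \<and>
     (\<exists>v. C1_into_L2_with_deriv {0..<T} u v \<and>
          L1_L1 {0<..<T} (\<lambda>t x. G (v t x)) \<and>
          (AE x in lebesgue. u 0 x = \<epsilon> * f x) \<and>
          (AE x in lebesgue. v 0 x = \<epsilon> * g x) \<and>
          (\<forall>\<psi>. test_function T \<psi> \<longrightarrow>
             \<epsilon> * (LINT x|lebesgue. g x * \<psi> (x, 0))
               + (LINT t|lebesgue_on {0<..<T}. LINT x|lebesgue. G (v t x) * \<psi> (x, t))
             = (LINT t|lebesgue_on {0<..<T}. LINT x|lebesgue.
                  - v t x * deriv (\<lambda>s. \<psi> (x, s)) t
                  + weak_grad (u t) x \<bullet> grad (\<lambda>y. \<psi> (y, t)) x)))"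

end

(* Test the equation with the truncated plane wave w x = exp (l * (x \<bullet> e)), e a unit coordinate vector, times
   functions of time. Since Laplace w = l^2 w on the support of u, the pairings U = <u, w>, B = <\<partial>_t u, w>,
   A = <G (\<partial>_t u), w> satisfy U' = B and U'' = l^2 U + A weakly, so Duhamel's formula bounds exp (- l * t) * B t
   below by a multiple of \<epsilon> plus half the time integral of exp (- l * s) * A s; the initial
   contribution is positive because the integral of g is and l is small. The wave moves with speed one,
   so exp (- l * t) * w has mass O((1 + t)^((N - 1) / 2)) on the ball of radius r0 + t, and Hoelder's inequality
   bounds A below by B^p times the corresponding weight. The resulting integral inequality of Riccati
   type is solvable only up to the asserted time. *)
theory Submission
  imports Defs "HOL-Probability.Probability"
begin

section \<open>Smooth functions and cutoffs\<close>

text \<open>On the ball of radius \<open>R\<close> the mass of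
  \<open>exp (l * (x \<bullet> e))\<close> sits in a cap at \<open>R * e\<close>, of bounded
  thickness and of width about \<open>sqrt R\<close> in each of the \<open>N - 1\<close> transverse
  directions. A single direction therefore suffices in every dimension, without averaging waves over
  the sphere. Hoelder's inequality raises the mass to the power \<open>1 - p\<close>, so the time
  weight is \<open>(1 + s) powr (- \<kappa>)\<close> with
  \<open>\<kappa> = (N - 1) * (p - 1) / 2\<close>. As
  \<open>Gamma_G N p = (1 - \<kappa>) / (p - 1)\<close>, the assumption on \<open>Gamma_G\<close>
  says that this weight is not integrable at infinity; \<open>\<kappa> < 1\<close> leads to a power
  of \<open>\<epsilon>\<close>, \<open>\<kappa> = 1\<close> to an exponential.

  Low regularity shapes the rest. \<open>A\<close> is merely integrable in time, so the growth of
  \<open>B\<close> has to be read off the weak identity. The cone condition concerns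
  \<open>u\<close>, and has to be transferred to its time derivative. Test functions need compact
  support, so the truncation depends on \<open>T\<close>; the constants do not, because the mass is
  bounded by that of the full wave. Finally \<open>g + l * f\<close> feeds the growing mode of the
  linear equation and \<open>g - l * f\<close> the decaying one, so both pairings need a
  sign.\<close>

lemma Ck_SucD: "Ck (Suc k) f \<Longrightarrow> Ck k f"
proof (induction k arbitrary: f)
  case 0
  then show ?case
    by (auto intro!: continuous_at_imp_continuous_on differentiable_imp_continuous_within)
next
  case (Suc k)
  then show ?case by (metis Ck.simps(2))
qed

lemma Ck_const: "Ck k (\<lambda>x. c)"
  by (induction k arbitrary: c) (auto simp: frechet_derivative_const)

lemma Ck_add:
  assumes "Ck k f" "Ck k g"
  shows "Ck k (\<lambda>x. f x + g x)"
  using assms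
proof (induction k arbitrary: f g)
  case 0
  then show ?case by (auto intro: continuous_intros)
next
  case (Suc k)
  then have "frechet_derivative (\<lambda>x. f x + g x) (at x) v
      = frechet_derivative f (at x) v + frechet_derivative g (at x) v" for x v
  proof -
    have "(f has_derivative frechet_derivative f (at x)) (at x)"
      "(g has_derivative frechet_derivative g (at x)) (at x)"
      using Suc.prems by (auto simp: frechet_derivative_works)
    from frechet_derivative_at[OF has_derivative_add[OF this], symmetric]
    show ?thesis by simp
  qed
  moreover have "(\<lambda>x. f x + g x) differentiable (at x)" for x
    using Suc.prems by (auto intro: differentiable_add)
  ultimately show ?case using Suc by auto
qed

lemma Ck_mult:
  assumes "Ck k f" "Ck k g"
  shows "Ck k (\<lambda>x. f x * g x)"
  using assms
proof (induction k arbitrary: f g)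
  case 0
  then show ?case by (auto intro: continuous_intros)
next
  case (Suc k)
  have "frechet_derivative (\<lambda>x. f x * g x) (at x) v
      = f x * frechet_derivative g (at x) v + frechet_derivative f (at x) v * g x" for x v
  proof -
    have "(f has_derivative frechet_derivative f (at x)) (at x)"
      "(g has_derivative frechet_derivative g (at x)) (at x)"
      using Suc.prems by (auto simp: frechet_derivative_works)
    from frechet_derivative_at[OF has_derivative_mult[OF this], symmetric]
    show ?thesis by simp
  qed
  moreover have "Ck k (\<lambda>x. f x * frechet_derivative g (at x) v + frechet_derivative f (at x) v * g x)" for v
    using Suc.prems Ck_SucD[OF Suc.prems(1)] Ck_SucD[OF Suc.prems(2)]
    by (intro Ck_add Suc.IH) auto
  ultimately show ?case using Suc.prems by auto
qed

lemma Ck_compose_affine: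
  fixes h :: "'b::euclidean_space \<Rightarrow> real" and l :: "'a::euclidean_space \<Rightarrow> 'b"
  assumes "Ck k h" "bounded_linear l"
  shows "Ck k (\<lambda>x. h (l x + c))"
  using assms(1)
proof (induction k arbitrary: h)
  case 0
  then show ?case
    using continuous_on_compose2[of UNIV h UNIV "\<lambda>x. l x + c"]
      continuous_on_add[OF linear_continuous_on[OF assms(2)] continuous_on_const]
    by auto
next
  case (Suc k)
  have d: "((\<lambda>x. h (l x + c)) has_derivative
      (\<lambda>v. frechet_derivative h (at (l x + c)) (l v))) (at x)" for x
  proof -
    have "(h has_derivative frechet_derivative h (at (l x + c))) (at (l x + c))"
      using Suc.prems by (simp add: frechet_derivative_works)
    moreover have "((\<lambda>x. l x + c) has_derivative l) (at x)"
      using bounded_linear_imp_has_derivative[OF assms(2)] by (auto intro!: derivative_eq_intros)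
    ultimately show ?thesis by (rule has_derivative_compose[rotated])
  qed
  have "frechet_derivative (\<lambda>x. h (l x + c)) (at x) v = frechet_derivative h (at (l x + c)) (l v)" for x v
    using fun_cong[OF frechet_derivative_at[OF d[of x]], of v] by simp
  moreover have "Ck k (\<lambda>x. frechet_derivative h (at (l x + c)) (l v))" for v
    using Suc.prems by (intro Suc.IH) auto
  moreover have "(\<lambda>x. h (l x + c)) differentiable (at x)" for x
    using d by (rule differentiableI)
  ultimately show ?case by simp
qed

lemma smooth_const: "smooth (\<lambda>x. a)"
  and smooth_add: "smooth f \<Longrightarrow> smooth g \<Longrightarrow> smooth (\<lambda>x. f x + g x)"
  and smooth_mult: "smooth f \<Longrightarrow> smooth g \<Longrightarrow> smooth (\<lambda>x. f x * g x)"
  and smooth_compose_affine: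
    "smooth h \<Longrightarrow> bounded_linear l \<Longrightarrow> smooth (\<lambda>x. h (l x + c))"
  by (simp_all add: smooth_def Ck_const Ck_add Ck_mult Ck_compose_affine)

lemma smooth_prod:
  assumes "\<And>i. i \<in> I \<Longrightarrow> smooth (f i)"
  shows "smooth (\<lambda>x. \<Prod>i\<in>I. f i x)"
  using assms by (induction I rule: infinite_finite_induct) (auto intro: smooth_const smooth_mult)

lemma smooth_imp_continuous: "smooth f \<Longrightarrow> continuous_on S f"
  unfolding smooth_def using Ck.simps(1) continuous_on_subset by blast

lemma smooth_imp_differentiable: "smooth f \<Longrightarrow> f differentiable (at x)"
  unfolding smooth_def using Ck.simps(2) by blast

lemma smooth_frechet_derivative: "smooth f \<Longrightarrow> smooth (\<lambda>x. frechet_derivative f (at x) v)"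
  unfolding smooth_def using Ck.simps(2) by blast

text \<open>In one variable every directional derivative is a constant multiple of
  \<open>f'\<close>, so regularity of \<open>f'\<close> alone suffices.\<close>

lemma Ck_Suc_realI:
  fixes f :: "real \<Rightarrow> real"
  assumes d: "\<And>x. (f has_real_derivative f' x) (at x)" and k: "Ck k f'"
  shows "Ck (Suc k) f"
proof -
  have "frechet_derivative f (at x) = (\<lambda>v. f' x * v)" for x
    using frechet_derivative_at[OF d[of x, unfolded has_field_derivative_def]] by simp
  moreover have "f differentiable (at x)" for x
    using d[of x] by (auto simp: real_differentiable_def)
  ultimately show ?thesis using k by (auto intro: Ck_mult Ck_const)
qed

lemma smooth_real_primitive:
  fixes f :: "real \<Rightarrow> real"
  assumes "\<And>x. (f has_real_derivative f' x) (at x)" "smooth f'"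
  shows "smooth f"
  using Ck_SucD[OF Ck_Suc_realI[OF assms(1)]] assms(2) by (simp add: smooth_def)

lemma smooth_exp: "smooth (exp :: real \<Rightarrow> real)"
proof -
  have "Ck k (exp :: real \<Rightarrow> real)" for k
    by (induction k) (auto simp del: Ck.simps(2) intro!: Ck_Suc_realI continuous_intros derivative_eq_intros)
  then show ?thesis by (simp add: smooth_def)
qed

lemma smooth_cosh: "smooth (cosh :: real \<Rightarrow> real)"
proof -
  have "smooth (\<lambda>x::real. (exp (x + 0) + exp (- x + 0)) * (1 / 2))"
    by (intro smooth_mult smooth_add smooth_const smooth_compose_affine smooth_exp
        bounded_linear_ident bounded_linear_minus)
  then show ?thesis by (simp add: cosh_def[abs_def] field_simps)
qed

section \<open>A function flat at the origin, and smooth steps\<close>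

lemma poly_times_exp_minus_tendsto_0:
  fixes q :: "real poly"
  shows "((\<lambda>y. poly q y * exp (- y)) \<longlongrightarrow> 0) at_top"
proof -
  have "((\<lambda>y::real. y ^ n * exp (- y)) \<longlongrightarrow> 0) at_top" for n
    using tendsto_power_div_exp_0[of n] by (simp add: exp_minus divide_inverse)
  then have "((\<lambda>y. \<Sum>i\<le>degree q. coeff q i * (y ^ i * exp (- y))) \<longlongrightarrow> 0) at_top"
    by (intro tendsto_null_sum tendsto_mult_right_zero)
  then show ?thesis by (simp add: poly_altdef sum_distrib_right mult.assoc)
qed

text \<open>\<open>flat 1\<close> is the classical smooth function that is not analytic at the
  origin. The polynomial in \<open>1 / x\<close> makes the family closed under differentiation: with
  \<open>y = 1 / x\<close>, differentiating sends \<open>q\<close> to \<open>y^2 * (q - q')\<close>.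
  One induction over all \<open>q\<close> then yields every order of smoothness.\<close>

definition flat :: "real poly \<Rightarrow> real \<Rightarrow> real" where
  "flat q x = (if x > 0 then poly q (1 / x) * exp (- (1 / x)) else 0)"

lemma flat_has_derivative:
  "(flat q has_real_derivative flat ([:0, 0, 1:] * (q - pderiv q)) x) (at x)"
proof -
  consider "x > 0" | "x < 0" | "x = 0" by linarith
  then show ?thesis
  proof cases
    case 1
    have *: "((\<lambda>x. poly q (1 / x) * exp (- (1 / x))) has_real_derivative
        flat ([:0, 0, 1:] * (q - pderiv q)) x) (at x)"
      unfolding flat_def using 1
      by (auto intro!: derivative_eq_intros DERIV_chain2[OF poly_DERIV] simp: field_simps power2_eq_square)
    show ?thesis
      by (rule has_field_derivative_transform_within_open[OF *, of "{0<..}"]) (use 1 in \<open>auto simp: flat_def\<close>)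
  next
    case 2
    have "((\<lambda>x. 0) has_real_derivative flat ([:0, 0, 1:] * (q - pderiv q)) x) (at x)"
      using 2 by (auto simp: flat_def)
    then show ?thesis
      by (rule has_field_derivative_transform_within_open[of _ _ _ "{..<0}"]) (use 2 in \<open>auto simp: flat_def\<close>)
  next
    case 3
    \<comment> \<open>At the origin the difference quotient \<open>flat q h / h\<close> is of the
      same type, with \<open>q\<close> multiplied by the variable \<open>1 / h\<close>, and the
      exponential beats every polynomial.\<close>
    have "((\<lambda>h. poly ([:0, 1:] * q) (1 / h) * exp (- (1 / h))) \<longlongrightarrow> 0) (at_right 0)"
      using filterlim_compose[OF poly_times_exp_minus_tendsto_0[of "[:0, 1:] * q"] filterlim_inverse_at_top_right]
      by (simp add: inverse_eq_divide)
    then have r: "((\<lambda>h. flat q h / h) \<longlongrightarrow> 0) (at_right 0)"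
      by (rule Lim_transform_eventually)
         (auto simp: flat_def eventually_at_right_less intro!: eventually_mono[OF eventually_at_right_less])
    have l: "((\<lambda>h. flat q h / h) \<longlongrightarrow> 0) (at_left 0)"
      by (rule Lim_transform_eventually[OF tendsto_const])
         (auto simp: flat_def eventually_at_left_field intro!: exI[of _ "-1"])
    have "((\<lambda>h. flat q h / h) \<longlongrightarrow> 0) (at 0)"
      using l r filterlim_at_split by blast
    then show ?thesis using 3 by (simp add: DERIV_def flat_def)
  qed
qed

lemma smooth_flat: "smooth (flat q)"
proof -
  have "Ck k (flat q)" for k
  proof (induction k arbitrary: q)
    case 0
    then show ?case
      using DERIV_isCont[OF flat_has_derivative] by (simp add: continuous_at_imp_continuous_on)
  next
    case (Suc k)
    then show ?case using Ck_Suc_realI[OF flat_has_derivative] by blast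
  qed
  then show ?thesis by (simp add: smooth_def)
qed

text \<open>The step is the normalised primitive of a bump, the product of \<open>flat 1\<close>
  with its reflection, which is positive exactly between 0 and 1.\<close>

lemma smooth_step_exists:
  obtains S :: "real \<Rightarrow> real" where "smooth S" "mono S" "\<And>x. x \<le> 0 \<Longrightarrow> S x = 0" "\<And>x. 1 \<le> x \<Longrightarrow> S x = 1"
proof -
  define \<beta> where "\<beta> x = flat 1 x * flat 1 (- x + 1)" for x
  have s\<beta>: "smooth \<beta>"
    unfolding \<beta>_def[abs_def]
    by (intro smooth_mult smooth_flat smooth_compose_affine bounded_linear_minus bounded_linear_ident)
  note c\<beta> = smooth_imp_continuous[OF s\<beta>]
  have nn: "\<beta> x \<ge> 0" for x by (simp add: \<beta>_def flat_def)
  have z: "\<beta> x = 0" if "x \<le> 0 \<or> x \<ge> 1" for x using that by (auto simp: \<beta>_def flat_def)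
  \<comment> \<open>The lower limit lies to the left of the bump, so that the origin is interior to
    the interval of integration and the fundamental theorem gives a two-sided derivative there.
    Further left \<open>P\<close> is locally zero.\<close>
  define P where "P x = integral {-1..x} \<beta>" for x
  have int: "\<beta> integrable_on {a..b}" for a b by (intro integrable_continuous_real c\<beta>)
  have P0: "P x = 0" if "x \<le> 0" for x
  proof -
    have "P x = integral {-1..x} (\<lambda>x. 0)"
      unfolding P_def by (rule integral_cong) (use that z in auto)
    then show ?thesis by simp
  qed
  have P_add: "P y = P x + integral {x..y} \<beta>" if "-1 \<le> x" "x \<le> y" for x y
    unfolding P_def using Henstock_Kurzweil_Integration.integral_combine[OF that int] by simp
  have P1: "P x = P 1" if "x \<ge> 1" for x
  proof -
    have "integral {1..x} \<beta> = integral {1..x} (\<lambda>x. 0)"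
      by (rule integral_cong) (use z in auto)
    then show ?thesis using P_add[of 1 x] that by simp
  qed
  have dP: "(P has_real_derivative \<beta> x) (at x)" for x
  proof (cases "x \<le> -1/2")
    case True
    have "((\<lambda>x. 0) has_real_derivative \<beta> x) (at x)" using True z by simp
    then show ?thesis
      by (rule has_field_derivative_transform_within_open[of _ _ _ "{..<0}"]) (use True P0 in auto)
  next
    case False
    have "(P has_real_derivative \<beta> x) (at x within {-1..x+1})"
      unfolding P_def by (rule integral_has_real_derivative) (use False c\<beta> in auto)
    moreover have "at x within {-1..x+1} = at x"
      by (rule at_within_interior) (use False in auto)
    ultimately show ?thesis by simp
  qed
  have mP: "mono P"
  proof (rule monoI)
    fix x y :: real
    assume "x \<le> y"
    then show "P x \<le> P y"
      by (rule DERIV_nonneg_imp_nondecreasing[of x y P]) (rule exI, rule conjI, rule dP, rule nn)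
  qed
  have "P 1 > 0"
  proof -
    have "P 0 < P 1"
    proof (rule DERIV_pos_imp_increasing_open[of 0 1 P])
      show "\<exists>y. (P has_real_derivative y) (at x) \<and> 0 < y" if "0 < x" "x < 1" for x
        using that by (intro exI[of _ "\<beta> x"] conjI dP) (simp add: \<beta>_def flat_def)
      show "continuous_on {0..1} P" by (intro continuous_at_imp_continuous_on ballI DERIV_isCont[OF dP])
    qed auto
    then show ?thesis using P0 by simp
  qed
  show thesis
  proof
    show "smooth (\<lambda>x. P x * (1 / P 1))"
      by (intro smooth_mult smooth_const smooth_real_primitive[OF dP s\<beta>])
    show "mono (\<lambda>x. P x * (1 / P 1))"
      using mP \<open>P 1 > 0\<close> by (auto simp: mono_def divide_right_mono)
    show "P x * (1 / P 1) = 1" if "1 \<le> x" for x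
      using P1[OF that] \<open>P 1 > 0\<close> by simp
  qed (simp add: P0)
qed

section \<open>Ordinary differential inequalities\<close>

lemma smooth_cutoff_above:
  fixes a b :: real
  assumes "a < b"
  obtains \<sigma> :: "real \<Rightarrow> real" where "smooth \<sigma>" "antimono \<sigma>"
    "\<And>s. s \<le> a \<Longrightarrow> \<sigma> s = 1" "\<And>s. s \<ge> b \<Longrightarrow> \<sigma> s = 0"
proof -
  obtain S :: "real \<Rightarrow> real"
    where S: "smooth S" "mono S" "\<And>x. x \<le> 0 \<Longrightarrow> S x = 0" "\<And>x. x \<ge> 1 \<Longrightarrow> S x = 1"
    by (rule smooth_step_exists) blast
  define \<sigma> where "\<sigma> s = S (- (1 / (b - a)) * s + b / (b - a))" for s
  have e: "- (1 / (b - a)) * s + b / (b - a) = (b - s) / (b - a)" for s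
    by (simp add: diff_divide_distrib)
  show thesis
  proof
    show "smooth \<sigma>"
      unfolding \<sigma>_def[abs_def] by (intro smooth_compose_affine S bounded_linear_mult_right)
    show "antimono \<sigma>"
      unfolding \<sigma>_def e using S(2) assms by (auto simp: antimono_def mono_def divide_right_mono)
    show "\<sigma> s = 1" if "s \<le> a" for s
      unfolding \<sigma>_def e by (rule S(4)) (use that assms in \<open>simp add: field_simps\<close>)
    show "\<sigma> s = 0" if "s \<ge> b" for s
      unfolding \<sigma>_def e by (rule S(3)) (use that assms in \<open>simp add: field_simps\<close>)
  qed
qed

text \<open>The weak formulation integrates over the open interval up to \<open>T\<close>, whereas
  calculus is done on \<open>{0..t1}\<close>. The two agree because the endpoint 0 is a null set and
  the integrand vanishes from \<open>t1\<close> on; nothing is assumed about its behaviour near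
  \<open>T\<close>.\<close>

lemma lebesgue_integral_eq_integral_vanishing:
  fixes f :: "real \<Rightarrow> real"
  assumes f: "continuous_on {0..t1} f" and z: "\<And>s. s \<ge> t1 \<Longrightarrow> f s = 0" and t1: "0 \<le> t1" "t1 < T"
  shows "integrable (lebesgue_on {0<..<T}) f" "(LINT s|lebesgue_on {0<..<T}. f s) = integral {0..t1} f"
proof -
  have i: "integrable (lebesgue_on {0..t1}) f"
    using f by (rule continuous_imp_integrable_real)
  then have h: "(f has_integral (LINT s|lebesgue_on {0..t1}. f s)) {0..t1}"
    by (simp add: has_integral_integral_lebesgue_on)
  have a: "AE s in lebesgue. s \<noteq> (0::real)"
    by (rule AE_completion, rule AE_lborel_singleton)
  have "integrable lebesgue (\<lambda>s. indicator {0..t1} s *\<^sub>R f s)"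
    using i by (simp add: integrable_restrict_space)
  moreover have ae: "AE s in lebesgue. indicator {0..t1} s *\<^sub>R f s = indicator {0<..<T} s *\<^sub>R f s"
    using a by eventually_elim (use z t1 in \<open>auto simp: indicator_def not_le\<close>)
  ultimately have "integrable lebesgue (\<lambda>s. indicator {0<..<T} s *\<^sub>R f s)"
    using borel_measurable_AE[OF _ ae] integrable_cong_AE_imp[OF _ _ ae] by blast
  then show "integrable (lebesgue_on {0<..<T}) f"
    by (simp add: integrable_restrict_space)
  have "(LINT s|lebesgue_on {0<..<T}. f s) = (LINT s|lebesgue. indicator {0<..<T} s *\<^sub>R f s)"
    by (simp add: integral_restrict_space)
  also have "\<dots> = (LINT s|lebesgue. indicator {0..t1} s *\<^sub>R f s)"
    by (rule integral_cong_AE) (use ae i \<open>integrable lebesgue (\<lambda>s. indicator {0<..<T} s *\<^sub>R f s)\<close>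
        in \<open>auto simp: integrable_restrict_space elim!: eventually_mono\<close>)
  also have "\<dots> = (LINT s|lebesgue_on {0..t1}. f s)"
    by (simp add: integral_restrict_space)
  also have "\<dots> = integral {0..t1} f"
    using lebesgue_integral_eq_integral[OF i] by simp
  finally show "(LINT s|lebesgue_on {0<..<T}. f s) = integral {0..t1} f" .
qed

text \<open>Testing with \<open>cosh (l * (t - s))\<close>, cut off just after \<open>t\<close>, gives one half of Duhamel's formula
  for \<open>U'' = l\<^sup>2 U + A\<close>; only a lower bound \<open>k\<close> of the merely integrable \<open>A\<close> is kept.\<close>

lemma weak_duhamel_lower_bound:
  fixes A B U k :: "real \<Rightarrow> real"
  assumes t: "0 \<le> t" "t < T"
    and B: "continuous_on {0..<T} B"
    and U: "\<And>s. s \<in> {0..<T} \<Longrightarrow> (U has_real_derivative B s) (at s within {0..<T})"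
    and A: "integrable (lebesgue_on {0<..<T}) A"
    and k: "continuous_on {0..<T} k" "\<And>s. s \<in> {0..<T} \<Longrightarrow> 0 \<le> k s"
    and Ak: "AE s in lebesgue_on {0<..<T}. k s \<le> A s"
    and weak: "\<And>h t1. smooth h \<Longrightarrow> 0 < t1 \<Longrightarrow> t1 < T \<Longrightarrow> (\<And>s. s \<ge> t1 \<Longrightarrow> h s = 0) \<Longrightarrow>
      B 0 * h 0 + (LINT s|lebesgue_on {0<..<T}. A s * h s)
      = (LINT s|lebesgue_on {0<..<T}. - B s * deriv h s - l\<^sup>2 * U s * h s)"
  shows "B 0 * cosh (l * t) + l * U 0 * sinh (l * t) + integral {0..t} (\<lambda>s. k s * cosh (l * (t - s))) \<le> B t"
proof (rule field_le_epsilon)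
  fix e :: real assume e: "0 < e"
  \<comment> \<open>\<open>F\<close> is the Duhamel combination. It satisfies
    \<open>F t = B t\<close>, and it is what the derivative of the cutoff will be paired
    with.\<close>
  define F where "F s = B s * cosh (l * (t - s)) + l * U s * sinh (l * (t - s))" for s
  have U_cont: "continuous_on {0..<T} U"
    using U DERIV_continuous_on by blast
  have F_cont: "continuous_on {0..<T} F"
    unfolding F_def by (intro continuous_intros B U_cont)
  moreover have "t \<in> {0..<T}" using t by simp
  ultimately obtain d where d: "d > 0" "\<And>s. s \<in> {0..<T} \<Longrightarrow> dist s t < d \<Longrightarrow> dist (F s) (F t) < e"
    using e unfolding continuous_on_iff by blast
  \<comment> \<open>The cutoff drops from 1 to 0 inside \<open>{t..t1}\<close>, on which
    \<open>F\<close> exceeds \<open>F t\<close> by at most \<open>e\<close>.\<close>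
  define t1 where "t1 = t + min (d / 2) ((T - t) / 2)"
  have t1: "t < t1" "t1 < T" "\<And>s. t \<le> s \<Longrightarrow> s \<le> t1 \<Longrightarrow> dist s t < d"
    using d(1) t min.cobounded1[of "d / 2" "(T - t) / 2"] min.cobounded2[of "d / 2" "(T - t) / 2"]
    by (auto simp: t1_def dist_real_def simp del: min.cobounded1 min.cobounded2)
  then have t1_pos: "0 < t1" using t by simp
  have sub: "{0..t1} \<subseteq> {0..<T}" using t1 by auto
  note B' = continuous_on_subset[OF B sub] and U_cont' = continuous_on_subset[OF U_cont sub]
    and k' = continuous_on_subset[OF k(1) sub] and F' = continuous_on_subset[OF F_cont sub]
  obtain \<sigma> :: "real \<Rightarrow> real" where \<sigma>: "smooth \<sigma>" "antimono \<sigma>"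
      "\<And>s. s \<le> t \<Longrightarrow> \<sigma> s = 1" "\<And>s. s \<ge> t1 \<Longrightarrow> \<sigma> s = 0"
    using smooth_cutoff_above[OF t1(1)] by blast
  define \<sigma>' where "\<sigma>' = deriv \<sigma>"
  have d\<sigma>: "(\<sigma> has_real_derivative \<sigma>' s) (at s)" for s
    using smooth_imp_differentiable[OF \<sigma>(1)] unfolding \<sigma>'_def
    by (simp add: DERIV_deriv_iff_real_differentiable)
  have "\<sigma>' s = frechet_derivative \<sigma> (at s) 1" for s
    using frechet_derivative_at[OF d\<sigma>[of s, unfolded has_field_derivative_def]] by (metis mult.right_neutral)
  then have \<sigma>'_cont: "continuous_on X \<sigma>'" for X
    using smooth_imp_continuous[OF smooth_frechet_derivative[OF \<sigma>(1)], of X 1] by presburger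
  note \<sigma>_cont = smooth_imp_continuous[OF \<sigma>(1)]
  have \<sigma>_bounds: "0 \<le> \<sigma> s" "\<sigma> s \<le> 1" for s
    using antimonoD[OF \<sigma>(2), of s "max s t1"] antimonoD[OF \<sigma>(2), of "min s t" s] \<sigma>(3,4) by auto
  have \<sigma>'_nonpos: "\<sigma>' s \<le> 0" for s
  proof -
    have "0 \<le> - \<sigma>' s"
      by (rule mono_on_imp_deriv_nonneg[of UNIV "\<lambda>s. - \<sigma> s"])
         (use \<sigma>(2) in \<open>auto simp: mono_on_def antimono_def intro!: derivative_eq_intros d\<sigma>\<close>)
    then show ?thesis by simp
  qed
  have \<sigma>'_0: "\<sigma>' s = 0" if "s \<le> t \<or> t1 \<le> s" for s
    using that
  proof
    assume "s \<le> t"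
    then show ?thesis
      by (intro DERIV_local_max[OF d\<sigma>, of 1]) (simp_all add: \<sigma>(3) \<sigma>_bounds)
  next
    assume "t1 \<le> s"
    then show ?thesis
      by (intro DERIV_local_min[OF d\<sigma>, of 1]) (simp_all add: \<sigma>(4) \<sigma>_bounds)
  qed
  define h where "h s = cosh (l * (t - s)) * \<sigma> s" for s
  have h_smooth: "smooth h"
  proof -
    have "smooth (\<lambda>s. cosh (- l * s + l * t) * \<sigma> s)"
      by (intro smooth_mult smooth_compose_affine smooth_cosh \<sigma> bounded_linear_mult_right)
    then show ?thesis by (simp add: h_def[abs_def] algebra_simps)
  qed
  have dh: "deriv h s = - l * sinh (l * (t - s)) * \<sigma> s + cosh (l * (t - s)) * \<sigma>' s" for s
    unfolding h_def by (rule DERIV_imp_deriv) (auto intro!: derivative_eq_intros d\<sigma>)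
  have h_0: "h s = 0" if "s \<ge> t1" for s using that \<sigma>(4) by (simp add: h_def)
  have h_cont: "continuous_on X h" for X using smooth_imp_continuous[OF h_smooth] .
  have h_nonneg: "h s \<ge> 0" for s using \<sigma>_bounds by (simp add: h_def)

  have "B 0 * cosh (l * t) + integral {0..t} (\<lambda>s. k s * cosh (l * (t - s)))
      \<le> B 0 * h 0 + (LINT s|lebesgue_on {0<..<T}. A s * h s)"
  proof -
    have kh: "continuous_on {0..t1} (\<lambda>s. k s * h s)" by (intro continuous_intros k' h_cont)
    have "integral {0..t} (\<lambda>s. k s * cosh (l * (t - s))) = integral {0..t} (\<lambda>s. k s * h s)"
      by (rule integral_cong) (auto simp: h_def \<sigma>)
    also have "\<dots> \<le> integral {0..t1} (\<lambda>s. k s * h s)"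
      by (rule integral_subset_le)
         (use t1 kh sub h_nonneg k(2) in \<open>auto intro!: integrable_continuous_real intro: continuous_on_subset\<close>)
    also have "\<dots> = (LINT s|lebesgue_on {0<..<T}. k s * h s)"
      by (rule lebesgue_integral_eq_integral_vanishing(2)[symmetric]) (use kh t1 t1_pos h_0 in auto)
    also have "\<dots> \<le> (LINT s|lebesgue_on {0<..<T}. A s * h s)"
    proof (rule integral_mono_AE)
      show "integrable (lebesgue_on {0<..<T}) (\<lambda>s. k s * h s)"
        by (rule lebesgue_integral_eq_integral_vanishing(1)) (use kh t1 t1_pos h_0 in auto)
      have "bounded (h ` {0..T})"
        by (intro compact_imp_bounded compact_continuous_image h_cont) simp
      then obtain c where c: "\<And>s. s \<in> {0..T} \<Longrightarrow> \<bar>h s\<bar> \<le> c"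
        unfolding bounded_iff by (auto simp del: atLeastAtMost_iff)
      show "integrable (lebesgue_on {0<..<T}) (\<lambda>s. A s * h s)"
      proof (rule Bochner_Integration.integrable_bound)
        show "integrable (lebesgue_on {0<..<T}) (\<lambda>s. c * A s)" using A by simp
        show "(\<lambda>s. A s * h s) \<in> borel_measurable (lebesgue_on {0<..<T})"
          by (intro borel_measurable_times borel_measurable_integrable[OF A]
              continuous_imp_measurable_on_sets_lebesgue h_cont) simp
        show "AE s in lebesgue_on {0<..<T}. norm (A s * h s) \<le> norm (c * A s)"
        proof (rule AE_I2)
          fix s assume "s \<in> space (lebesgue_on {0<..<T})"
          then have "\<bar>h s\<bar> \<le> \<bar>c\<bar>" using c[of s] by auto
          then show "norm (A s * h s) \<le> norm (c * A s)"
            by (simp add: abs_mult mult.commute[of "\<bar>c\<bar>"] mult_left_mono)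
        qed
      qed
      show "AE s in lebesgue_on {0<..<T}. k s * h s \<le> A s * h s"
        using Ak by eventually_elim (use h_nonneg in \<open>auto intro: mult_right_mono\<close>)
    qed
    finally show ?thesis using t by (simp add: h_def \<sigma>)
  qed
  also have "\<dots> = (LINT s|lebesgue_on {0<..<T}. - B s * deriv h s - l\<^sup>2 * U s * h s)"
    by (rule weak[OF h_smooth t1_pos t1(2) h_0])
  also have "\<dots> = integral {0..t1} (\<lambda>s. - B s * deriv h s - l\<^sup>2 * U s * h s)"
    by (rule lebesgue_integral_eq_integral_vanishing(2))
       (auto simp: h_0 \<sigma>(4) \<sigma>'_0 t1 t1_pos less_imp_le dh intro!: continuous_intros B' U_cont' h_cont \<sigma>'_cont \<sigma>_cont)
  also have "\<dots> = - l * U 0 * sinh (l * t) + integral {0..t1} (\<lambda>s. F s * (- \<sigma>' s))"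
  proof -
    \<comment> \<open>Integration by parts in disguise: this integrand is the derivative of
      \<open>l * U s * sinh (l * (t - s)) * \<sigma> s\<close>. Removing it from
      \<open>- B s * deriv h s - l\<^sup>2 * U s * h s\<close> leaves exactly
      \<open>F s * (- \<sigma>' s)\<close>, plus a boundary term at 0, since
      \<open>\<sigma> t1 = 0\<close>.\<close>
    have "((\<lambda>s. B s * l * sinh (l * (t - s)) * \<sigma> s - l\<^sup>2 * U s * cosh (l * (t - s)) * \<sigma> s
        + l * U s * sinh (l * (t - s)) * \<sigma>' s) has_integral
        l * U t1 * sinh (l * (t - t1)) * \<sigma> t1 - l * U 0 * sinh (l * (t - 0)) * \<sigma> 0) {0..t1}"
    proof (rule fundamental_theorem_of_calculus)
      fix s assume s: "s \<in> {0..t1}"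
      have U': "(U has_real_derivative B s) (at s within {0..t1})"
        using U[of s] s sub by (meson DERIV_subset subsetD)
      have \<sigma>s: "(\<sigma> has_real_derivative \<sigma>' s) (at s within {0..t1})"
        using d\<sigma> DERIV_subset by blast
      show "((\<lambda>s. l * U s * sinh (l * (t - s)) * \<sigma> s) has_vector_derivative
          B s * l * sinh (l * (t - s)) * \<sigma> s - l\<^sup>2 * U s * cosh (l * (t - s)) * \<sigma> s
          + l * U s * sinh (l * (t - s)) * \<sigma>' s) (at s within {0..t1})"
        unfolding has_real_derivative_iff_has_vector_derivative[symmetric]
        by (auto intro!: derivative_eq_intros U' \<sigma>s simp: algebra_simps power2_eq_square)
    qed (use t1_pos in simp)
    moreover have "((\<lambda>s. F s * (- \<sigma>' s)) has_integral integral {0..t1} (\<lambda>s. F s * (- \<sigma>' s))) {0..t1}"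
      by (intro integrable_integral integrable_continuous_real continuous_intros F' \<sigma>'_cont)
    ultimately have *: "((\<lambda>s. (B s * l * sinh (l * (t - s)) * \<sigma> s - l\<^sup>2 * U s * cosh (l * (t - s)) * \<sigma> s
        + l * U s * sinh (l * (t - s)) * \<sigma>' s) + F s * (- \<sigma>' s)) has_integral
        (l * U t1 * sinh (l * (t - t1)) * \<sigma> t1 - l * U 0 * sinh (l * (t - 0)) * \<sigma> 0)
        + integral {0..t1} (\<lambda>s. F s * (- \<sigma>' s))) {0..t1}"
      by (rule has_integral_add)
    have "((\<lambda>s. - B s * deriv h s - l\<^sup>2 * U s * h s) has_integral
        - l * U 0 * sinh (l * t) + integral {0..t1} (\<lambda>s. F s * (- \<sigma>' s))) {0..t1}"
      using * t \<sigma>(3)[of 0] \<sigma>(4)[of t1] by (simp add: F_def dh h_def algebra_simps)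
    then show ?thesis by (rule integral_unique)
  qed
  \<comment> \<open>\<open>- \<sigma>'\<close> is a probability density carried by
    \<open>{t..t1}\<close>, so the integral is an average of \<open>F\<close> near
    \<open>t\<close>.\<close>
  also have "integral {0..t1} (\<lambda>s. F s * (- \<sigma>' s)) \<le> integral {0..t1} (\<lambda>s. (F t + e) * (- \<sigma>' s))"
  proof (rule integral_le)
    show "(\<lambda>s. F s * - \<sigma>' s) integrable_on {0..t1}" "(\<lambda>s. (F t + e) * - \<sigma>' s) integrable_on {0..t1}"
      by (intro integrable_continuous_real continuous_intros F' \<sigma>'_cont)+
    fix s assume s: "s \<in> {0..t1}"
    show "F s * - \<sigma>' s \<le> (F t + e) * - \<sigma>' s"
    proof (cases "s < t")
      case False
      then have "F s \<le> F t + e" using d(2)[of s] t1(3)[of s] s sub by (fastforce simp: dist_real_def)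
      then show ?thesis using \<sigma>'_nonpos[of s] by (intro mult_right_mono) auto
    qed (simp add: \<sigma>'_0)
  qed
  also have "integral {0..t1} (\<lambda>s. (F t + e) * (- \<sigma>' s)) = F t + e"
  proof -
    have "(\<sigma>' has_integral (\<sigma> t1 - \<sigma> 0)) {0..t1}"
      by (rule fundamental_theorem_of_calculus)
         (use t1_pos DERIV_subset[OF d\<sigma>] in \<open>auto simp flip: has_real_derivative_iff_has_vector_derivative\<close>)
    then have "((\<lambda>s. (F t + e) * (- \<sigma>' s)) has_integral (F t + e) * (- (\<sigma> t1 - \<sigma> 0))) {0..t1}"
      by (intro has_integral_mult_right has_integral_neg)
    from integral_unique[OF this] show ?thesis using \<sigma>(3)[of 0] \<sigma>(4)[of t1] t by simp
  qed
  also have "F t = B t" by (simp add: F_def)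
  finally show "B 0 * cosh (l * t) + l * U 0 * sinh (l * t) + integral {0..t} (\<lambda>s. k s * cosh (l * (t - s))) \<le> B t + e"
    by simp
qed

text \<open>Let \<open>Y\<close> be the left side of \<open>ineq\<close>. Then
  \<open>Y' = m * \<beta> powr p \<ge> m * Y powr p\<close>, so
  \<open>Y powr (1 - p) + (p - 1) * integral m\<close> does not increase; it starts at
  \<open>J powr (1 - p)\<close>, and its first summand stays nonnegative. Only \<open>Y\<close> is
  differentiated, \<open>\<beta>\<close> being merely continuous.\<close>

lemma superlinear_integral_inequality:
  fixes m \<beta> :: "real \<Rightarrow> real"
  assumes p: "1 < p" and J: "0 < J" and t: "0 \<le> t" "t < T"
    and m: "continuous_on {0..<T} m" "\<And>s. s \<in> {0..<T} \<Longrightarrow> 0 \<le> m s"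
    and \<beta>: "continuous_on {0..<T} \<beta>" "\<And>s. s \<in> {0..<T} \<Longrightarrow> 0 \<le> \<beta> s"
    and ineq: "\<And>s. s \<in> {0..<T} \<Longrightarrow> J + integral {0..s} (\<lambda>r. m r * \<beta> r powr p) \<le> \<beta> s"
  shows "(p - 1) * integral {0..t} m \<le> J powr (1 - p)"
proof -
  have sub: "{0..t} \<subseteq> {0..<T}" using t by auto
  note m' = continuous_on_subset[OF m(1) sub] and \<beta>' = continuous_on_subset[OF \<beta>(1) sub]
  define y where "y s = m s * \<beta> s powr p" for s
  define Y where "Y s = J + integral {0..s} y" for s
  define M where "M s = integral {0..s} m" for s
  have y_cont: "continuous_on {0..t} y"
    unfolding y_def using p \<beta>(2) sub
    by (intro continuous_on_mult continuous_on_powr' m' \<beta>' continuous_on_const) auto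
  have y_nonneg: "0 \<le> y s" if "s \<in> {0..t}" for s using that sub m(2) by (auto simp: y_def)
  have dY: "(Y has_real_derivative y s) (at s within {0..t})" if "s \<in> {0..t}" for s
    unfolding Y_def using integral_has_real_derivative[OF y_cont that] by (auto intro!: derivative_eq_intros)
  have dM: "(M has_real_derivative m s) (at s within {0..t})" if "s \<in> {0..t}" for s
    unfolding M_def using integral_has_real_derivative[OF m' that] .
  have Y_pos: "J \<le> Y s" if "s \<in> {0..t}" for s
    unfolding Y_def using that y_nonneg
    by (auto intro!: Henstock_Kurzweil_Integration.integral_nonneg integrable_continuous_real
        intro: continuous_on_subset[OF y_cont])
  have Y_le: "Y s \<le> \<beta> s" if "s \<in> {0..t}" for s
    using ineq[of s] that sub unfolding Y_def y_def by auto
  define Z where "Z s = Y s powr (1 - p) + (p - 1) * M s" for s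
  define Z' where "Z' s = (1 - p) * Y s powr (- p) * y s + (p - 1) * m s" for s
  have dZ: "(Z has_real_derivative Z' s) (at s within {0..t})" if s: "s \<in> {0..t}" for s
    unfolding Z_def Z'_def using Y_pos[OF s] J
    by (auto intro!: derivative_eq_intros dY[OF s] dM[OF s])
  have "Z t \<le> Z 0"
  proof (rule DERIV_nonpos_imp_decreasing_open[of 0 t Z])
    show "continuous_on {0..t} Z" using dZ DERIV_continuous_on by blast
    fix s assume s: "0 < s" "s < t"
    have "m s * (Y s powr (- p) * Y s powr p) \<le> m s * (Y s powr (- p) * \<beta> s powr p)"
      using s t Y_le[of s] Y_pos[of s] J m(2)[of s] p by (intro mult_left_mono powr_mono2) auto
    moreover have "Y s powr (- p) * Y s powr p = 1"
      using Y_pos[of s] s J by (simp flip: powr_add)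
    ultimately have "m s \<le> Y s powr (- p) * y s" by (simp add: y_def mult_ac)
    then have "Z' s \<le> 0"
      using mult_left_mono[of _ _ "p - 1"] p unfolding Z'_def by (fastforce simp: algebra_simps)
    moreover have "at s within {0..t} = at s"
      using s by (intro at_within_interior) simp
    ultimately show "\<exists>z. (Z has_real_derivative z) (at s) \<and> z \<le> 0"
      using dZ[of s] s by auto
  qed (use t in simp)
  moreover have "Z 0 = J powr (1 - p)" by (simp add: Z_def Y_def M_def)
  ultimately have "Y t powr (1 - p) + (p - 1) * M t \<le> J powr (1 - p)" by (simp only: Z_def)
  then show ?thesis using powr_ge_zero[of "Y t" "1 - p"] by (simp only: M_def)
qed

text \<open>For \<open>\<beta> s = exp (- l * s) * B s\<close> the exponentials cancel: the Duhamel
  factor \<open>exp (- l * r)\<close> and the weight \<open>exp (- l * (p - 1) * r)\<close> combine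
  to \<open>exp (- l * p * r)\<close>, which turns \<open>B r powr p\<close> into
  \<open>\<beta> r powr p\<close>. The halves of \<open>c\<close> and \<open>E\<close> stem from
  \<open>cosh x \<ge> exp x / 2\<close>.\<close>

lemma lifespan_integral_bound:
  fixes A B U :: "real \<Rightarrow> real"
  assumes p: "1 < p" and l: "0 < l" and E: "0 < E" and c: "0 < c"
    and t: "0 \<le> t" "t < T"
    and B: "continuous_on {0..<T} B"
    and U: "\<And>s. s \<in> {0..<T} \<Longrightarrow> (U has_real_derivative B s) (at s within {0..<T})"
    and init: "E \<le> B 0 + l * U 0" "0 \<le> B 0 - l * U 0"
    and A: "integrable (lebesgue_on {0<..<T}) A"
    and A_ge: "AE s in lebesgue_on {0<..<T}. 0 \<le> A s \<and>
      (0 < B s \<longrightarrow> c * (1 + s) powr (- \<kappa>) * exp (- l * (p - 1) * s) * B s powr p \<le> A s)"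
    and weak: "\<And>h t1. smooth h \<Longrightarrow> 0 < t1 \<Longrightarrow> t1 < T \<Longrightarrow> (\<And>s. s \<ge> t1 \<Longrightarrow> h s = 0) \<Longrightarrow>
      B 0 * h 0 + (LINT s|lebesgue_on {0<..<T}. A s * h s)
      = (LINT s|lebesgue_on {0<..<T}. - B s * deriv h s - l\<^sup>2 * U s * h s)"
  shows "(p - 1) * (c / 2) * integral {0..t} (\<lambda>s. (1 + s) powr (- \<kappa>)) \<le> (E / 2) powr (1 - p)"
proof -
  \<comment> \<open>The positive part avoids a circle. The bound on \<open>A\<close> is available
    only where \<open>B\<close> is positive, and positivity of \<open>B\<close> is itself deduced
    from Duhamel's formula, for which any nonnegative continuous minorant of \<open>A\<close> will
    do.\<close>
  define k where "k s = c * (1 + s) powr (- \<kappa>) * exp (- l * (p - 1) * s) * max 0 (B s) powr p" for s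
  have k_cont: "continuous_on {0..<T} k"
    unfolding k_def using p
    by (intro continuous_on_mult continuous_on_powr' continuous_on_max continuous_on_const B
        continuous_on_add continuous_on_id continuous_on_exp) auto
  have k_nonneg: "0 \<le> k s" for s using c by (simp add: k_def)
  have Ak: "AE s in lebesgue_on {0<..<T}. k s \<le> A s"
    using A_ge by eventually_elim (auto simp: k_def max_def not_le)
  define \<beta> where "\<beta> s = exp (- l * s) * B s" for s
  have lower: "E / 2 + integral {0..s} (\<lambda>r. (exp (- l * r) * k r) / 2) \<le> \<beta> s" if s: "s \<in> {0..<T}" for s
  proof -
    have sub: "{0..s} \<subseteq> {0..<T}" using s by auto
    note k' = continuous_on_subset[OF k_cont sub]
    have "exp (l * s) * (E / 2 + integral {0..s} (\<lambda>r. (exp (- l * r) * k r) / 2))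
      = exp (l * s) * (E / 2) + integral {0..s} (\<lambda>r. k r * (exp (l * (s - r)) / 2))"
    proof -
      have "integral {0..s} (\<lambda>r. k r * (exp (l * (s - r)) / 2))
          = integral {0..s} (\<lambda>r. exp (l * s) * ((exp (- l * r) * k r) / 2))"
      proof (rule integral_cong)
        fix r
        have "exp (l * (s - r)) = exp (l * s) * exp (- l * r)"
          by (simp add: right_diff_distrib flip: exp_add)
        then show "k r * (exp (l * (s - r)) / 2) = exp (l * s) * ((exp (- l * r) * k r) / 2)"
          by simp
      qed
      then show ?thesis by (simp only: distrib_left integral_mult_right)
    qed
    also have "\<dots> \<le> (B 0 * cosh (l * s) + l * U 0 * sinh (l * s)) + integral {0..s} (\<lambda>r. k r * cosh (l * (s - r)))"
    proof (rule add_mono)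
      \<comment> \<open>Splitting into growing and decaying modes shows the use of the two initial
        conditions: the first gives the growth, the second lets the decaying mode be
        dropped.\<close>
      have "exp (l * s) * (E / 2) \<le> exp (l * s) * ((B 0 + l * U 0) / 2) + exp (- (l * s)) * ((B 0 - l * U 0) / 2)"
      proof -
        have "exp (l * s) * (E / 2) \<le> exp (l * s) * ((B 0 + l * U 0) / 2)"
          using init by (intro mult_left_mono) auto
        moreover have "0 \<le> exp (- (l * s)) * ((B 0 - l * U 0) / 2)" using init by simp
        ultimately show ?thesis by linarith
      qed
      also have "\<dots> = B 0 * cosh (l * s) + l * U 0 * sinh (l * s)"
        by (simp add: cosh_def sinh_def field_simps)
      finally show "exp (l * s) * (E / 2) \<le> B 0 * cosh (l * s) + l * U 0 * sinh (l * s)" .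
      show "integral {0..s} (\<lambda>r. k r * (exp (l * (s - r)) / 2)) \<le> integral {0..s} (\<lambda>r. k r * cosh (l * (s - r)))"
        by (intro integral_le integrable_continuous_real continuous_intros k' mult_left_mono k_nonneg)
           (auto simp: cosh_def)
    qed
    also have "\<dots> \<le> B s"
      by (rule weak_duhamel_lower_bound[OF _ _ B U A k_cont k_nonneg Ak weak]) (use s in auto)
    also have "B s = exp (l * s) * \<beta> s" by (simp add: \<beta>_def flip: exp_add)
    finally show ?thesis by simp
  qed
  have "E / 2 \<le> \<beta> s" if s: "s \<in> {0..<T}" for s
  proof -
    have "0 \<le> integral {0..s} (\<lambda>r. (exp (- l * r) * k r) / 2)"
      using s by (intro Henstock_Kurzweil_Integration.integral_nonneg integrable_continuous_real continuous_intros
          continuous_on_subset[OF k_cont]) (auto simp: k_nonneg)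
    then show ?thesis using lower[OF s] by simp
  qed
  then have \<beta>_pos: "0 < \<beta> s" if "s \<in> {0..<T}" for s using that E by fastforce
  have "(p - 1) * integral {0..t} (\<lambda>s. (c / 2) * (1 + s) powr (- \<kappa>)) \<le> (E / 2) powr (1 - p)"
  proof (rule superlinear_integral_inequality[OF p _ t])
    show "continuous_on {0..<T} (\<lambda>s. c / 2 * (1 + s) powr - \<kappa>)"
      by (intro continuous_intros) auto
    show "continuous_on {0..<T} \<beta>" unfolding \<beta>_def by (intro continuous_intros B)
    fix s assume s: "s \<in> {0..<T}"
    have "c / 2 * (1 + r) powr - \<kappa> * \<beta> r powr p = (exp (- l * r) * k r) / 2" if r: "r \<in> {0..s}" for r
    proof -
      have "0 < B r" using \<beta>_pos[of r] r s by (simp add: \<beta>_def zero_less_mult_iff)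
      moreover have "exp (- l * r) powr p = exp (- l * r) * exp (- l * (p - 1) * r)"
        by (simp add: powr_def algebra_simps flip: exp_add)
      ultimately show ?thesis by (simp add: k_def \<beta>_def powr_mult)
    qed
    then have "integral {0..s} (\<lambda>r. c / 2 * (1 + r) powr - \<kappa> * \<beta> r powr p)
        = integral {0..s} (\<lambda>r. (exp (- l * r) * k r) / 2)"
      by (intro integral_cong) auto
    then show "E / 2 + integral {0..s} (\<lambda>r. c / 2 * (1 + r) powr - \<kappa> * \<beta> r powr p) \<le> \<beta> s"
      using lower[OF s] by simp
  qed (use E c \<beta>_pos in \<open>auto intro: less_imp_le\<close>)
  then show ?thesis by (simp add: mult.assoc)
qed

section \<open>Primitives of the time weight\<close>

lemma integral_one_plus_powr:
  fixes t :: real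
  assumes "0 \<le> t" "\<kappa> \<noteq> 1"
  shows "integral {0..t} (\<lambda>s. (1 + s) powr (- \<kappa>)) = ((1 + t) powr (1 - \<kappa>) - 1) / (1 - \<kappa>)"
proof -
  have "((\<lambda>s. (1 + s) powr (- \<kappa>)) has_integral
      (1 + t) powr (1 - \<kappa>) / (1 - \<kappa>) - (1 + 0) powr (1 - \<kappa>) / (1 - \<kappa>)) {0..t}"
    using assms by (intro fundamental_theorem_of_calculus)
      (auto intro!: derivative_eq_intros simp flip: has_real_derivative_iff_has_vector_derivative)
  then show ?thesis by (simp add: integral_unique diff_divide_distrib)
qed

lemma integral_one_plus_powr_minus_one:
  fixes t :: real
  assumes "0 \<le> t"
  shows "integral {0..t} (\<lambda>s. (1 + s) powr (- 1)) = ln (1 + t)"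
proof -
  have "((\<lambda>s. (1 + s) powr (- 1)) has_integral ln (1 + t) - ln (1 + 0)) {0..t}"
    using assms by (intro fundamental_theorem_of_calculus)
      (auto intro!: derivative_eq_intros simp: powr_minus divide_inverse
        simp flip: has_real_derivative_iff_has_vector_derivative)
  then show ?thesis by (simp add: integral_unique)
qed

section \<open>Pairings in space\<close>

lemma integrable_L2_mult:
  fixes f g :: "'a::euclidean_space \<Rightarrow> real"
  assumes "L2 f" "L2 g"
  shows "integrable lebesgue (\<lambda>x. f x * g x)"
proof (rule Bochner_Integration.integrable_bound)
  show "integrable lebesgue (\<lambda>x. (f x)\<^sup>2 + (g x)\<^sup>2)"
    using assms by (simp add: L2_def)
  show "(\<lambda>x. f x * g x) \<in> borel_measurable lebesgue"
    using assms by (intro borel_measurable_times) (simp_all add: L2_def)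
  have "\<bar>a * b\<bar> \<le> a\<^sup>2 + b\<^sup>2" for a b :: real
  proof -
    have "2 * \<bar>a * b\<bar> \<le> a\<^sup>2 + b\<^sup>2"
      using sum_squares_bound[of "\<bar>a\<bar>" "\<bar>b\<bar>"] by (simp add: abs_mult)
    then show ?thesis by linarith
  qed
  then show "AE x in lebesgue. norm (f x * g x) \<le> norm ((f x)\<^sup>2 + (g x)\<^sup>2)"
    by (intro AE_I2) simp
qed

lemma Cauchy_Schwarz_L2:
  fixes f g :: "'a::euclidean_space \<Rightarrow> real"
  assumes f: "L2 f" and g: "L2 g"
  shows "\<bar>LINT x|lebesgue. f x * g x\<bar> \<le> norm_L2 f * norm_L2 g"
proof -
  have m: "f \<in> borel_measurable lebesgue" "g \<in> borel_measurable lebesgue"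
    using f g by (simp_all add: L2_def)
  define I where "I = (LINT x|lebesgue. \<bar>f x * g x\<bar>)"
  have sq: "(\<integral>\<^sup>+x. (ennreal \<bar>h x\<bar>)\<^sup>2 \<partial>lebesgue) = ennreal ((norm_L2 h)\<^sup>2)" if "L2 h" for h :: "'a \<Rightarrow> real"
    using that unfolding L2_def norm_L2_def
    by (simp add: ennreal_power nn_integral_eq_integral)
  have "ennreal (I\<^sup>2) = (\<integral>\<^sup>+x. ennreal \<bar>f x\<bar> * ennreal \<bar>g x\<bar> \<partial>lebesgue)\<^sup>2"
  proof -
    have "(\<integral>\<^sup>+x. ennreal \<bar>f x * g x\<bar> \<partial>lebesgue) = ennreal I"
      unfolding I_def using integrable_L2_mult[OF f g] by (intro nn_integral_eq_integral) auto
    moreover have "0 \<le> I" by (simp add: I_def)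
    ultimately show ?thesis by (simp add: abs_mult ennreal_mult ennreal_power)
  qed
  also have "\<dots> \<le> (\<integral>\<^sup>+x. (ennreal \<bar>f x\<bar>)\<^sup>2 \<partial>lebesgue) * (\<integral>\<^sup>+x. (ennreal \<bar>g x\<bar>)\<^sup>2 \<partial>lebesgue)"
    by (intro Cauchy_Schwarz_nn_integral measurable_compose[OF _ measurable_ennreal] borel_measurable_abs m)
  also have "\<dots> = ennreal ((norm_L2 f * norm_L2 g)\<^sup>2)"
    by (simp add: sq f g power_mult_distrib ennreal_mult)
  finally have "I\<^sup>2 \<le> (norm_L2 f * norm_L2 g)\<^sup>2" by simp
  moreover have "0 \<le> norm_L2 f * norm_L2 g" by (simp add: norm_L2_def)
  ultimately have "I \<le> norm_L2 f * norm_L2 g" by (rule power2_le_imp_le)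
  then show ?thesis unfolding I_def by (rule order_trans[OF integral_abs_bound])
qed

lemma L2_diff:
  fixes f g :: "'a::euclidean_space \<Rightarrow> real"
  assumes "L2 f" "L2 g"
  shows "L2 (\<lambda>x. f x - g x)"
  using assms integrable_L2_mult[OF assms] unfolding L2_def
  by (auto simp: power2_diff mult.assoc)

lemma L2_cmult:
  fixes f :: "'a::euclidean_space \<Rightarrow> real"
  assumes "L2 f"
  shows "L2 (\<lambda>x. c * f x)"
  using assms unfolding L2_def by (auto simp: power_mult_distrib)

lemma L2_inner_component:
  fixes w :: "'a::euclidean_space \<Rightarrow> 'a"
  assumes "L2 w"
  shows "L2 (\<lambda>x. w x \<bullet> b)"
  unfolding L2_def
proof
  show m: "(\<lambda>x. w x \<bullet> b) \<in> borel_measurable lebesgue"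
    using assms unfolding L2_def by (intro borel_measurable_inner) auto
  show "integrable lebesgue (\<lambda>x. (norm (w x \<bullet> b))\<^sup>2)"
  proof (rule Bochner_Integration.integrable_bound)
    show "integrable lebesgue (\<lambda>x. (norm b)\<^sup>2 * (norm (w x))\<^sup>2)"
      using assms by (simp add: L2_def)
    have "(w x \<bullet> b)\<^sup>2 \<le> (norm b)\<^sup>2 * (norm (w x))\<^sup>2" for x
      using power_mono[OF Cauchy_Schwarz_ineq2[of "w x" b], of 2] by (simp add: power_mult_distrib mult.commute)
    then show "AE x in lebesgue. norm ((norm (w x \<bullet> b))\<^sup>2) \<le> norm ((norm b)\<^sup>2 * (norm (w x))\<^sup>2)"
      by (intro AE_I2) simp
  qed (use m in simp)
qed

lemma supp_vanish: "x \<notin> supp f \<Longrightarrow> f x = 0"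
  unfolding supp_def using closure_subset[of "{x. f x \<noteq> 0}"] by auto

lemma integrable_continuous_compact_supp:
  fixes f :: "'a::euclidean_space \<Rightarrow> real"
  assumes "continuous_on UNIV f" "compact (supp f)"
  shows "integrable lebesgue f"
proof -
  have "integrable lborel (\<lambda>x. indicator (supp f) x *\<^sub>R f x)"
    by (rule borel_integrable_compact[OF assms(2)]) (use assms(1) continuous_on_subset in blast)
  also have "(\<lambda>x. indicator (supp f) x *\<^sub>R f x) = f"
  proof
    show "indicator (supp f) x *\<^sub>R f x = f x" for x
      by (cases "x \<in> supp f") (simp_all add: supp_vanish)
  qed
  finally show ?thesis by (simp add: integrable_completion borel_measurable_integrable)
qed

lemma L2_continuous_compact_supp:
  fixes f :: "'a::euclidean_space \<Rightarrow> real"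
  assumes c: "continuous_on UNIV f" and k: "compact (supp f)"
  shows "L2 f"
proof -
  have "supp (\<lambda>x. (f x)\<^sup>2) = supp f" by (simp add: supp_def)
  then have "integrable lebesgue (\<lambda>x. (f x)\<^sup>2)"
    using k by (intro integrable_continuous_compact_supp continuous_intros c) simp
  then show ?thesis
    using borel_measurable_integrable[OF integrable_continuous_compact_supp[OF c k]] by (simp add: L2_def)
qed

lemma L2_pairing_tendsto:
  fixes F :: "real \<Rightarrow> 'a::euclidean_space \<Rightarrow> real"
  assumes w: "L2 w" and F: "\<And>s. s \<in> I \<Longrightarrow> L2 (F s)" "L2 g"
    and lim: "((\<lambda>s. norm_L2 (\<lambda>x. F s x - g x)) \<longlongrightarrow> 0) (at t within I)"
  shows "((\<lambda>s. LINT x|lebesgue. F s x * w x) \<longlongrightarrow> (LINT x|lebesgue. g x * w x)) (at t within I)"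
proof -
  have "((\<lambda>s. (LINT x|lebesgue. F s x * w x) - (LINT x|lebesgue. g x * w x)) \<longlongrightarrow> 0) (at t within I)"
  proof (rule Lim_null_comparison)
    show "((\<lambda>s. norm_L2 (\<lambda>x. F s x - g x) * norm_L2 w) \<longlongrightarrow> 0) (at t within I)"
      using lim by (rule tendsto_mult_left_zero)
    have "norm ((LINT x|lebesgue. F s x * w x) - (LINT x|lebesgue. g x * w x))
        \<le> norm_L2 (\<lambda>x. F s x - g x) * norm_L2 w" if "s \<in> I" for s
    proof -
      have "(LINT x|lebesgue. F s x * w x) - (LINT x|lebesgue. g x * w x) = (LINT x|lebesgue. (F s x - g x) * w x)"
        using integrable_L2_mult[OF F(1)[OF that] w] integrable_L2_mult[OF F(2) w]
        by (simp add: left_diff_distrib)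
      then show ?thesis using Cauchy_Schwarz_L2[OF L2_diff[OF F(1)[OF that] F(2)] w] by simp
    qed
    then show "\<forall>\<^sub>F s in at t within I. norm ((LINT x|lebesgue. F s x * w x) - (LINT x|lebesgue. g x * w x))
        \<le> norm_L2 (\<lambda>x. F s x - g x) * norm_L2 w"
      by (auto simp: eventually_at_filter)
  qed
  then show ?thesis by (simp add: LIM_zero_iff)
qed

lemma continuous_on_L2_pairing:
  assumes "continuous_into_L2 I v" "L2 w"
  shows "continuous_on I (\<lambda>t. LINT x|lebesgue. v t x * w x)"
  using assms L2_pairing_tendsto[OF assms(2)] by (auto simp: continuous_on_def continuous_into_L2_def)

lemma has_real_derivative_L2_pairing:
  fixes u v :: "real \<Rightarrow> 'a::euclidean_space \<Rightarrow> real"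
  assumes uv: "C1_into_L2_with_deriv I u v" and w: "L2 w" and t: "t \<in> I"
  shows "((\<lambda>t. LINT x|lebesgue. u t x * w x) has_real_derivative (LINT x|lebesgue. v t x * w x)) (at t within I)"
proof -
  have u: "L2 (u s)" if "s \<in> I" for s using uv that by (auto simp: C1_into_L2_with_deriv_def)
  have "L2 (\<lambda>x. 1 / (s - t) * (u s x - u t x))" if "s \<in> I" for s
    using u t that by (intro L2_cmult L2_diff) auto
  then have "((\<lambda>s. LINT x|lebesgue. (u s x - u t x) / (s - t) * w x) \<longlongrightarrow> (LINT x|lebesgue. v t x * w x)) (at t within I)"
    using uv t by (intro L2_pairing_tendsto[OF w])
      (auto simp: C1_into_L2_with_deriv_def continuous_into_L2_def)
  moreover have "(LINT x|lebesgue. (u s x - u t x) / (s - t) * w x)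
      = ((LINT x|lebesgue. u s x * w x) - (LINT x|lebesgue. u t x * w x)) / (s - t)" if "s \<in> I" for s
  proof -
    have "(LINT x|lebesgue. (u s x - u t x) / (s - t) * w x)
        = (LINT x|lebesgue. (u s x * w x - u t x * w x) / (s - t))"
      by (rule Bochner_Integration.integral_cong) (simp_all add: left_diff_distrib)
    then show ?thesis
      by (simp only: integral_divide_zero
          Bochner_Integration.integral_diff[OF integrable_L2_mult[OF u[OF that] w] integrable_L2_mult[OF u[OF t] w]])
  qed
  then have "\<forall>\<^sub>F s in at t within I. (LINT x|lebesgue. (u s x - u t x) / (s - t) * w x)
      = ((LINT x|lebesgue. u s x * w x) - (LINT x|lebesgue. u t x * w x)) / (s - t)"
    by (intro eventually_at_topological[THEN iffD2] exI[of _ UNIV] conjI ballI impI open_UNIV UNIV_I)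
  ultimately show ?thesis
    by (simp add: has_field_derivative_iff Lim_transform_eventually)
qed

section \<open>Pairing integrable functions with bounded weights\<close>

lemma integrable_mult_bounded_lebesgue:
  fixes F w :: "'a::euclidean_space \<Rightarrow> real"
  assumes "integrable lebesgue F" "w \<in> borel_measurable lebesgue" "\<And>x. \<bar>w x\<bar> \<le> c"
  shows "integrable lebesgue (\<lambda>x. F x * w x)"
    and "\<bar>LINT x|lebesgue. F x * w x\<bar> \<le> c * (LINT x|lebesgue. \<bar>F x\<bar>)"
proof -
  have b: "\<bar>F x * w x\<bar> \<le> c * \<bar>F x\<bar>" for x
    using mult_right_mono[OF assms(3)[of x] abs_ge_zero[of "F x"]] by (simp add: abs_mult mult.commute)
  have i: "integrable lebesgue (\<lambda>x. c * \<bar>F x\<bar>)" using assms(1) by simp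
  show I: "integrable lebesgue (\<lambda>x. F x * w x)"
    by (rule Bochner_Integration.integrable_bound[OF i])
      (use assms(1,2) order_trans[OF b abs_ge_self] in \<open>auto intro!: AE_I2 simp del: abs_mult\<close>)
  have "\<bar>LINT x|lebesgue. F x * w x\<bar> \<le> (LINT x|lebesgue. norm (F x * w x))"
    by (simp add: integral_abs_bound)
  also have "\<dots> \<le> (LINT x|lebesgue. c * \<bar>F x\<bar>)"
    by (rule integral_mono) (use I i b in auto)
  finally show "\<bar>LINT x|lebesgue. F x * w x\<bar> \<le> c * (LINT x|lebesgue. \<bar>F x\<bar>)" by simp
qed

text \<open>Joint measurability in space and time is not assumed, so Fubini's theorem cannot supply
  measurability in \<open>t\<close>. It comes from strong measurability: pairing the simple
  approximants with \<open>w\<close> gives finite combinations of indicators of level sets, and they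
  converge for almost every \<open>t\<close> because pairing with a bounded \<open>w\<close> is
  continuous in the \<open>L1\<close> norm.\<close>

lemma integrable_L1_pairing:
  fixes F :: "real \<Rightarrow> 'a::euclidean_space \<Rightarrow> real"
  assumes F: "L1_L1 I F" and I: "I \<in> sets lebesgue"
    and w: "w \<in> borel_measurable lebesgue" "\<And>x. \<bar>w x\<bar> \<le> c"
  shows "integrable (lebesgue_on I) (\<lambda>t. LINT x|lebesgue. F t x * w x)"
proof -
  define A where "A t = (LINT x|lebesgue. F t x * w x)" for t
  obtain s where fin: "\<And>n. finite (s n ` I)"
    and int: "\<And>n t. t \<in> I \<Longrightarrow> integrable lebesgue (s n t)"
    and meas: "\<And>n h. {t\<in>I. s n t = h} \<in> sets lebesgue"
    and lim: "AE t in lebesgue_on I. (\<lambda>n. LINT x|lebesgue. \<bar>s n t x - F t x\<bar>) \<longlonglongrightarrow> 0"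
    using F unfolding L1_L1_def strongly_measurable_L1_def by blast
  have FI: "AE t in lebesgue_on I. integrable lebesgue (F t)"
    using F unfolding L1_L1_def strongly_measurable_L1_def by blast
  define a where "a n t = indicator I t * (LINT x|lebesgue. s n t x * w x)" for n t
  have a_meas: "a n \<in> borel_measurable lebesgue" for n
  proof -
    have "a n t = (\<Sum>h\<in>s n ` I. (LINT x|lebesgue. h x * w x) * indicator {t\<in>I. s n t = h} t)" for t
    proof (cases "t \<in> I")
      case True
      have "(\<Sum>h\<in>s n ` I. (LINT x|lebesgue. h x * w x) * indicator {t\<in>I. s n t = h} t)
          = (\<Sum>h\<in>s n ` I. if h = s n t then (LINT x|lebesgue. h x * w x) else 0)"
        by (rule sum.cong) (use True in \<open>auto simp: indicator_def\<close>)
      then show ?thesis using True fin by (simp add: a_def)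
    qed (simp add: a_def indicator_def)
    then have "a n = (\<lambda>t. \<Sum>h\<in>s n ` I. (LINT x|lebesgue. h x * w x) * indicator {t\<in>I. s n t = h} t)"
      by blast
    moreover have "\<dots> \<in> borel_measurable lebesgue"
      by (intro borel_measurable_sum borel_measurable_times borel_measurable_const borel_measurable_indicator meas)
    ultimately show ?thesis by simp
  qed
  have "AE t in lebesgue_on I. (\<lambda>n. a n t) \<longlonglongrightarrow> A t"
    using lim FI AE_space
  proof eventually_elim
    case (elim t)
    then have t: "t \<in> I" by simp
    have "(\<lambda>n. a n t - A t) \<longlonglongrightarrow> 0"
    proof (rule Lim_null_comparison)
      show "(\<lambda>n. c * (LINT x|lebesgue. \<bar>s n t x - F t x\<bar>)) \<longlonglongrightarrow> 0"
        using elim(1) by (rule tendsto_mult_right_zero)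
      have "norm (a n t - A t) \<le> c * (LINT x|lebesgue. \<bar>s n t x - F t x\<bar>)" for n
      proof -
        have "a n t - A t = (LINT x|lebesgue. (s n t x - F t x) * w x)"
          using integrable_mult_bounded_lebesgue(1)[OF int[OF t, of n] w] integrable_mult_bounded_lebesgue(1)[OF elim(2) w] t
          by (simp add: a_def A_def left_diff_distrib)
        then show ?thesis
          using integrable_mult_bounded_lebesgue(2)[OF _ w, of "\<lambda>x. s n t x - F t x"] int[OF t, of n] elim(2) by simp
      qed
      then show "\<forall>\<^sub>F n in sequentially. norm (a n t - A t) \<le> c * (LINT x|lebesgue. \<bar>s n t x - F t x\<bar>)"
        by simp
    qed
    then show ?case by (simp add: LIM_zero_iff)
  qed
  then have "AE t in lebesgue. t \<in> I \<longrightarrow> (\<lambda>n. a n t) \<longlonglongrightarrow> A t"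
    using I by (simp add: AE_restrict_space_iff)
  then have ae: "AE t in lebesgue. lim (\<lambda>n. a n t) = indicator I t * A t"
    by eventually_elim (auto simp: indicator_def a_def limI)
  have "(\<lambda>t. indicator I t * A t) \<in> borel_measurable lebesgue"
    by (rule borel_measurable_AE[OF borel_measurable_lim_metric ae]) (rule a_meas)
  then have A_meas: "A \<in> borel_measurable (lebesgue_on I)"
    using I by (simp add: borel_measurable_restrict_space_iff mult.commute)
  show ?thesis
    unfolding A_def[symmetric]
  proof (rule Bochner_Integration.integrable_bound[OF _ A_meas])
    show "integrable (lebesgue_on I) (\<lambda>t. c * (LINT x|lebesgue. \<bar>F t x\<bar>))"
      using F by (simp add: L1_L1_def)
    show "AE t in lebesgue_on I. norm (A t) \<le> norm (c * (LINT x|lebesgue. \<bar>F t x\<bar>))"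
      using FI
    proof eventually_elim
      case (elim t)
      show ?case
        using integrable_mult_bounded_lebesgue(2)[OF elim w]
        unfolding A_def real_norm_def by (rule order_trans) (rule abs_ge_self)
    qed
  qed
qed

section \<open>Mass of a plane wave on a ball\<close>

text \<open>On \<open>norm x \<le> R\<close> one has \<open>x \<bullet> e - R \<le> - \<bar>x'\<bar>\<^sup>2 / (2 * R)\<close>, with \<open>x'\<close> the part of \<open>x\<close> orthogonal to \<open>e\<close>.
  Half of the exponent is kept and the other half is traded for this Gaussian, so the bound
  factorises and only \<open>N - 1\<close> coordinates contribute a power of \<open>R\<close>.\<close>

lemma plane_wave_ball_pointwise:
  fixes e x :: "'a::euclidean_space"
  assumes e: "e \<in> Basis" and l: "0 < l" and R: "0 < R" and x: "norm x \<le> R"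
  shows "exp (l * (x \<bullet> e)) \<le> exp (l * R) *
    (\<Prod>b\<in>Basis. if b = e then exp (l / 2 * (x \<bullet> b - R)) * indicator {-R..R} (x \<bullet> b)
       else exp (- (l / (4 * R)) * (x \<bullet> b)\<^sup>2))"
proof -
  define q where "q = (\<Sum>b\<in>Basis - {e}. (x \<bullet> b)\<^sup>2)"
  have "(norm x)\<^sup>2 = (\<Sum>b\<in>Basis. (x \<bullet> b)\<^sup>2)"
    unfolding power2_norm_eq_inner by (subst euclidean_inner) (simp add: power2_eq_square)
  then have n: "(norm x)\<^sup>2 = (x \<bullet> e)\<^sup>2 + q"
    unfolding q_def using e by (simp add: sum.remove)
  have xe: "\<bar>x \<bullet> e\<bar> \<le> R" using Basis_le_norm[OF e, of x] x by simp
  have "q \<le> R\<^sup>2 - (x \<bullet> e)\<^sup>2" using n power_mono[OF x, of 2] by simp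
  also have "\<dots> = (R - x \<bullet> e) * (R + x \<bullet> e)" by (simp add: power2_eq_square algebra_simps)
  also have "\<dots> \<le> (R - x \<bullet> e) * (2 * R)" using xe by (intro mult_left_mono) auto
  finally have "q / (4 * R) \<le> (R - x \<bullet> e) / 2" using R by (simp add: field_simps)
  then have "l * (q / (4 * R)) \<le> l * ((R - x \<bullet> e) / 2)"
    using l by (intro mult_left_mono) auto
  then have "exp (l * (x \<bullet> e)) \<le> exp (l * R + l / 2 * (x \<bullet> e - R) + - (l / (4 * R)) * q)"
    by (simp add: field_simps)
  also have "\<dots> = exp (l * R) * (exp (l / 2 * (x \<bullet> e - R)) * (\<Prod>b\<in>Basis - {e}. exp (- (l / (4 * R)) * (x \<bullet> b)\<^sup>2)))"
    unfolding q_def by (simp only: exp_add exp_sum[OF finite_Diff[OF finite_Basis]] sum_distrib_left mult.assoc)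
  also have "\<dots> = exp (l * R) *
    (\<Prod>b\<in>Basis. if b = e then exp (l / 2 * (x \<bullet> b - R)) * indicator {-R..R} (x \<bullet> b)
       else exp (- (l / (4 * R)) * (x \<bullet> b)\<^sup>2))"
    using xe by (subst prod.remove[OF finite_Basis e]) (auto simp: indicator_def abs_le_iff intro!: prod.cong)
  finally show ?thesis .
qed

lemma nn_integral_gaussian:
  assumes "0 < a"
  shows "(\<integral>\<^sup>+x. ennreal (exp (- a * x\<^sup>2)) \<partial>lborel) = ennreal (sqrt (pi / a))"
proof -
  define \<sigma> where "\<sigma> = sqrt (1 / (2 * a))"
  have \<sigma>: "0 < \<sigma>" "\<sigma>\<^sup>2 = 1 / (2 * a)" using assms by (simp_all add: \<sigma>_def)
  have eq: "exp (- a * x\<^sup>2) = sqrt (pi / a) * normal_density 0 \<sigma> x" for x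
    using assms by (simp add: normal_density_def \<sigma>(2) real_sqrt_divide)
  have "(\<integral>\<^sup>+x. ennreal (normal_density 0 \<sigma> x) \<partial>lborel) = ennreal 1"
    using \<sigma>(1) by (subst nn_integral_eq_integral) (auto simp: integrable_normal_density)
  then show ?thesis
    unfolding eq using assms by (simp add: ennreal_mult nn_integral_cmult)
qed

text \<open>Tonelli's theorem over the coordinates. The direction \<open>e\<close> contributes at
  most \<open>2 / l\<close> whatever the radius, and each transverse direction a full Gaussian
  integral, \<open>sqrt (4 * pi * R / l)\<close>.\<close>

lemma plane_wave_ball_integral:
  fixes e :: "'a::euclidean_space"
  assumes e: "e \<in> Basis" and l: "0 < l" and R: "0 < R"
  shows "(LINT x|lebesgue. exp (l * (x \<bullet> e)) * indicator (cball 0 R) x)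
    \<le> exp (l * R) * (2 / l * (sqrt (pi / (l / (4 * R)))) ^ (DIM('a) - 1))"
proof -
  define h where "h b s = (if b = e then exp (l / 2 * (s - R)) * indicator {-R..R} s
       else exp (- (l / (4 * R)) * s\<^sup>2))" for b s
  have h_meas [measurable]: "h b \<in> borel_measurable borel" for b
    unfolding h_def by (cases "b = e") simp_all
  have h_nonneg: "0 \<le> h b s" for b s by (simp add: h_def)
  have he: "(\<integral>\<^sup>+s. ennreal (h e s) \<partial>lborel) \<le> ennreal (2 / l)"
  proof -
    have "(\<integral>\<^sup>+s. ennreal (h e s) \<partial>lborel) = (\<integral>\<^sup>+s. ennreal (exp (l / 2 * (s - R))) * indicator {-R..R} s \<partial>lborel)"
      by (intro nn_integral_cong) (auto simp: h_def indicator_def)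
    also have "\<dots> = ennreal (2 / l * exp (l / 2 * (R - R)) - 2 / l * exp (l / 2 * (- R - R)))"
      using R l by (intro nn_integral_FTC_Icc) (auto intro!: derivative_eq_intros)
    also have "\<dots> \<le> ennreal (2 / l)" using l by (intro ennreal_leI) simp
    finally show ?thesis .
  qed
  have "(\<integral>\<^sup>+x. (\<Prod>b\<in>Basis. ennreal (h b (x \<bullet> b))) \<partial>(lborel :: 'a measure)) = (\<Prod>b\<in>Basis. \<integral>\<^sup>+s. ennreal (h b s) \<partial>lborel)"
    by (rule nn_integral_lborel_prod) auto
  also have "\<dots> = (\<integral>\<^sup>+s. ennreal (h e s) \<partial>lborel) * (\<Prod>b\<in>Basis - {e}. \<integral>\<^sup>+s. ennreal (h b s) \<partial>lborel)"
    using e by (simp add: prod.remove)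
  also have "(\<Prod>b\<in>Basis - {e}. \<integral>\<^sup>+s. ennreal (h b s) \<partial>lborel)
      = (\<Prod>b\<in>Basis - {e}. ennreal (sqrt (pi / (l / (4 * R)))))"
    using l R nn_integral_gaussian[of "l / (4 * R)"] by (intro prod.cong) (auto simp: h_def)
  also have "\<dots> = ennreal (sqrt (pi / (l / (4 * R))) ^ (DIM('a) - 1))"
    using e l R by (simp add: card_Diff_singleton ennreal_power)
  also have "(\<integral>\<^sup>+s. ennreal (h e s) \<partial>lborel) * ennreal (sqrt (pi / (l / (4 * R))) ^ (DIM('a) - 1))
      \<le> ennreal (2 / l) * ennreal (sqrt (pi / (l / (4 * R))) ^ (DIM('a) - 1))"
    using he by (intro mult_right_mono) auto
  also have "\<dots> = ennreal (2 / l * sqrt (pi / (l / (4 * R))) ^ (DIM('a) - 1))"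
    using l R by (intro ennreal_mult[symmetric]) auto
  finally have H: "(\<integral>\<^sup>+x. (\<Prod>b\<in>Basis. ennreal (h b (x \<bullet> b))) \<partial>(lborel :: 'a measure))
      \<le> ennreal (2 / l * sqrt (pi / (l / (4 * R))) ^ (DIM('a) - 1))" .
  have "ennreal (LINT x|lebesgue. exp (l * (x \<bullet> e)) * indicator (cball 0 R) x)
      \<le> (\<integral>\<^sup>+x. ennreal (exp (l * (x \<bullet> e)) * indicator (cball 0 R) x) \<partial>lborel)"
  proof -
    have "integrable lborel (\<lambda>x::'a. indicator (cball 0 R) x *\<^sub>R exp (l * (x \<bullet> e)))"
      by (intro borel_integrable_compact continuous_intros) simp
    then have "integrable lborel (\<lambda>x::'a. exp (l * (x \<bullet> e)) * indicator (cball 0 R) x)"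
      by (simp add: mult.commute)
    then show ?thesis
      by (subst nn_integral_eq_integral) (auto simp: integral_completion borel_measurable_integrable)
  qed
  also have "\<dots> \<le> (\<integral>\<^sup>+x. ennreal (exp (l * R)) * (\<Prod>b\<in>Basis. ennreal (h b (x \<bullet> b))) \<partial>lborel)"
  proof (rule nn_integral_mono)
    fix x :: 'a
    have "exp (l * (x \<bullet> e)) * indicator (cball 0 R) x \<le> exp (l * R) * (\<Prod>b\<in>Basis. h b (x \<bullet> b))"
      using plane_wave_ball_pointwise[OF e l R, of x] h_nonneg
      by (auto simp: indicator_def h_def intro!: prod_nonneg mult_nonneg_nonneg)
    then show "ennreal (exp (l * (x \<bullet> e)) * indicator (cball 0 R) x)
        \<le> ennreal (exp (l * R)) * (\<Prod>b\<in>Basis. ennreal (h b (x \<bullet> b)))"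
      by (simp add: prod_ennreal h_nonneg prod_nonneg ennreal_leI flip: ennreal_mult)
  qed
  also have "\<dots> \<le> ennreal (exp (l * R)) * ennreal (2 / l * sqrt (pi / (l / (4 * R))) ^ (DIM('a) - 1))"
    using H by (subst nn_integral_cmult) (auto intro: mult_left_mono)
  also have "\<dots> = ennreal (exp (l * R) * (2 / l * sqrt (pi / (l / (4 * R))) ^ (DIM('a) - 1)))"
    using l R by (intro ennreal_mult[symmetric]) auto
  finally show ?thesis using l R by (subst (asm) ennreal_le_iff) auto
qed

section \<open>Finite speed of propagation and truncated plane waves\<close>

text \<open>Each point outside the support brings its own neighbourhood and its own null set.
  Lindelof's theorem extracts a countable subcover of the time slice, so that the union of the null
  sets is still null.\<close>

lemma spacetime_supp_cone_AE:
  fixes u :: "real \<Rightarrow> 'a::euclidean_space \<Rightarrow> real"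
  assumes cone: "spacetime_supp T u \<subseteq> {(x, t). t \<in> {0..T} \<and> norm x \<le> r + t}" and t: "t \<in> {0..<T}"
  shows "AE x in lebesgue. r + t < norm x \<longrightarrow> u t x = 0"
proof -
  define \<V> where "\<V> = {V. open V \<and> (AE x in lebesgue. x \<in> V \<longrightarrow> u t x = 0)}"
  obtain \<W> where W: "\<W> \<subseteq> \<V>" "countable \<W>" "\<Union>\<W> = \<Union>\<V>"
    using Lindelof[of \<V>] unfolding \<V>_def by blast
  have cover: "x \<in> \<Union>\<V>" if "r + t < norm x" for x
  proof -
    have "(x, t) \<notin> spacetime_supp T u" using cone that by auto
    then obtain U where U: "open U" "(x, t) \<in> U" "AE y in lebesgue. (y, t) \<in> U \<longrightarrow> u t y = 0"
      using t unfolding spacetime_supp_def by auto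
    have "open ((\<lambda>y. (y, t)) -` U)"
      using U(1) by (intro open_vimage continuous_intros)
    then have "(\<lambda>y. (y, t)) -` U \<in> \<V>" using U(3) by (simp add: \<V>_def)
    then show ?thesis using U(2) by (intro UnionI) auto
  qed
  have "AE x in lebesgue. \<forall>V\<in>\<W>. x \<in> V \<longrightarrow> u t x = 0"
    using W(1) by (subst AE_ball_countable[OF W(2)]) (auto simp: \<V>_def)
  then show ?thesis
    by eventually_elim (use cover W(3) in blast)
qed

text \<open>Where \<open>norm x\<close> exceeds \<open>r + t + 1\<close>, the difference quotients
  of \<open>u\<close> vanish for all \<open>s < t + 1\<close>, so the error \<open>D s\<close>
  equals \<open>- v t\<close> there, while its norm tends to 0. The margin 1 leaves room for times
  after \<open>t\<close>; it later costs only a constant factor.\<close>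

lemma time_derivative_vanishes_AE:
  fixes u v :: "real \<Rightarrow> 'a::euclidean_space \<Rightarrow> real"
  assumes uv: "C1_into_L2_with_deriv {0..<T} u v"
    and u0: "\<And>s. s \<in> {0..<T} \<Longrightarrow> AE x in lebesgue. r + s < norm x \<longrightarrow> u s x = 0"
    and t: "t \<in> {0..<T}"
  shows "AE x in lebesgue. r + t + 1 < norm x \<longrightarrow> v t x = 0"
proof -
  define S where "S = {x :: 'a. r + t + 1 < norm x}"
  have "open S" unfolding S_def by (intro open_Collect_less continuous_intros)
  then have S_meas: "S \<in> sets lebesgue" by simp
  have L2u: "L2 (u s)" and L2v: "L2 (v s)" if "s \<in> {0..<T}" for s
    using uv that by (auto simp: C1_into_L2_with_deriv_def continuous_into_L2_def)
  define D where "D s x = (u s x - u t x) / (s - t) - v t x" for s x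
  have L2D: "L2 (D s)" if "s \<in> {0..<T}" for s
  proof -
    have "L2 (\<lambda>x. 1 / (s - t) * (u s x - u t x) - v t x)"
      by (intro L2_diff L2_cmult L2u L2v that t)
    then show ?thesis by (simp add: D_def[abs_def])
  qed
  have int_v: "integrable lebesgue (\<lambda>x. (v t x)\<^sup>2 * indicator S x)"
    using L2v[OF t] S_meas by (intro integrable_real_mult_indicator) (simp_all add: L2_def)
  define q where "q = (LINT x|lebesgue. (v t x)\<^sup>2 * indicator S x)"
  have q_le: "q \<le> (norm_L2 (D s))\<^sup>2" if s: "s \<in> {0..<T}" "s < t + 1" for s
  proof -
    have "q \<le> (LINT x|lebesgue. (norm (D s x))\<^sup>2)"
      unfolding q_def
    proof (rule integral_mono_AE[OF int_v])
      show "integrable lebesgue (\<lambda>x. (norm (D s x))\<^sup>2)" using L2D[OF s(1)] by (simp add: L2_def)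
      show "AE x in lebesgue. (v t x)\<^sup>2 * indicator S x \<le> (norm (D s x))\<^sup>2"
        using u0[OF s(1)] u0[OF t]
        by eventually_elim (use s in \<open>auto simp: S_def D_def indicator_def\<close>)
    qed
    also have "\<dots> = (norm_L2 (D s))\<^sup>2" by (simp add: norm_L2_def)
    finally show ?thesis .
  qed
  have "((\<lambda>s. (norm_L2 (D s))\<^sup>2) \<longlongrightarrow> 0\<^sup>2) (at t within {0..<T})"
    using uv t unfolding D_def C1_into_L2_with_deriv_def by (intro tendsto_power) blast
  moreover have "\<forall>\<^sub>F s in at t within {0..<T}. q \<le> (norm_L2 (D s))\<^sup>2"
    unfolding eventually_at by (rule exI[of _ 1]) (auto simp: dist_real_def intro!: q_le)
  moreover have "at t within {0..<T} \<noteq> bot"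
    using t by (auto simp: trivial_limit_within islimpt_Ico)
  ultimately have "q \<le> 0" using tendsto_lowerbound by fastforce
  moreover have "0 \<le> q" unfolding q_def by simp
  ultimately have "AE x in lebesgue. (v t x)\<^sup>2 * indicator S x = 0"
    using integral_nonneg_eq_0_iff_AE[OF int_v] unfolding q_def by simp
  then show ?thesis
    by eventually_elim (auto simp: S_def)
qed

section \<open>Truncated plane waves\<close>

lemma frechet_derivative_plane_wave_open:
  fixes e :: "'a::euclidean_space"
  assumes "open X" "x \<in> X" "\<And>y. y \<in> X \<Longrightarrow> w y = c * exp (l * (y \<bullet> e))"
  shows "frechet_derivative w (at x) b = c * (l * (b \<bullet> e)) * exp (l * (x \<bullet> e))"
proof -
  have "((\<lambda>y. c * exp (l * (y \<bullet> e))) has_derivative (\<lambda>b. c * (l * (b \<bullet> e)) * exp (l * (x \<bullet> e)))) (at x)"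
    by (auto intro!: derivative_eq_intros)
  then have "(w has_derivative (\<lambda>b. c * (l * (b \<bullet> e)) * exp (l * (x \<bullet> e)))) (at x)"
    by (rule has_derivative_transform_within_open[OF _ assms(1,2)]) (simp add: assms(3))
  from fun_cong[OF frechet_derivative_at[OF this], of b] show ?thesis by simp
qed

text \<open>The wave equation for \<open>w\<close> is needed only where \<open>u\<close> may be
  nonzero, hence only for \<open>norm x < M\<close>. The bound by the full exponential holds
  everywhere, which keeps mass estimates independent of \<open>M\<close>.\<close>

lemma truncated_plane_wave:
  fixes e :: "'a::euclidean_space" and l M :: real
  obtains w :: "'a \<Rightarrow> real" where "smooth_compact w" "\<And>x. 0 \<le> w x" "\<And>x. w x \<le> exp (l * (x \<bullet> e))"
    "\<And>x. norm x < M \<Longrightarrow> w x = exp (l * (x \<bullet> e))"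
    "\<And>x b. norm x < M \<Longrightarrow>
      frechet_derivative (\<lambda>y. frechet_derivative w (at y) b) (at x) b = (l * (b \<bullet> e))\<^sup>2 * w x"
proof -
  obtain \<sigma> :: "real \<Rightarrow> real" where \<sigma>: "smooth \<sigma>" "antimono \<sigma>" "\<And>s. s \<le> M \<Longrightarrow> \<sigma> s = 1" "\<And>s. s \<ge> M + 1 \<Longrightarrow> \<sigma> s = 0"
    using smooth_cutoff_above[of M "M + 1"] by auto
  have \<sigma>_bounds: "0 \<le> \<sigma> s" "\<sigma> s \<le> 1" for s
    using antimonoD[OF \<sigma>(2), of s "max s (M + 1)"] antimonoD[OF \<sigma>(2), of "min s M" s] \<sigma>(3,4) by auto
  \<comment> \<open>A cube-shaped cutoff, made of one-variable cutoffs of the coordinates and their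
    negatives, needs only products and affine substitutions; a radial one would involve the norm,
    which is not smooth at the origin. The zeros added match
    \<open>smooth_compose_affine\<close>.\<close>
  define \<eta> where "\<eta> x = (\<Prod>b\<in>Basis. \<sigma> (x \<bullet> b + 0) * \<sigma> (x \<bullet> (- b) + 0))" for x :: 'a
  define w where "w x = exp (l * (x \<bullet> e) + 0) * \<eta> x" for x
  have \<eta>_bounds: "0 \<le> \<eta> x" "\<eta> x \<le> 1" for x
    unfolding \<eta>_def using \<sigma>_bounds by (auto intro!: prod_nonneg prod_le_1 mult_le_one)
  have \<eta>_1: "\<eta> x = 1" if "norm x < M" for x
    unfolding \<eta>_def using \<sigma>(3) that Basis_le_norm[of _ x] by (intro prod.neutral) fastforce
  have eq: "w x = 1 * exp (l * (x \<bullet> e))" if "x \<in> ball 0 M" for x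
    using \<eta>_1[of x] that by (simp add: w_def)
  have smooth_w: "smooth w"
    unfolding w_def[abs_def] \<eta>_def
    by (intro smooth_mult smooth_prod smooth_compose_affine smooth_exp \<sigma>(1) bounded_linear_inner_left
        bounded_linear_const_mult)
  have "{x. w x \<noteq> 0} \<subseteq> cbox (- (M + 1) *\<^sub>R One) ((M + 1) *\<^sub>R One)"
  proof
    fix x assume "x \<in> {x. w x \<noteq> 0}"
    then have nz: "\<sigma> (x \<bullet> b) \<noteq> 0" "\<sigma> (- (x \<bullet> b)) \<noteq> 0" if "b \<in> Basis" for b
      using that by (auto simp: w_def \<eta>_def)
    have "- (M + 1) \<le> x \<bullet> b \<and> x \<bullet> b \<le> M + 1" if "b \<in> Basis" for b
      using \<sigma>(4)[of "x \<bullet> b"] \<sigma>(4)[of "- (x \<bullet> b)"] nz[OF that] by linarith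
    then show "x \<in> cbox (- (M + 1) *\<^sub>R One) ((M + 1) *\<^sub>R One)"
      by (simp add: mem_box)
  qed
  then have "compact (supp w)"
    unfolding supp_def using bounded_subset[OF bounded_cbox] by (simp add: compact_closure)
  moreover have fd: "frechet_derivative w (at y) b = (l * (b \<bullet> e)) * exp (l * (y \<bullet> e))" if "y \<in> ball 0 M" for y b
    using frechet_derivative_plane_wave_open[OF open_ball that eq] by simp
  have "frechet_derivative (\<lambda>y. frechet_derivative w (at y) b) (at x) b = (l * (b \<bullet> e))\<^sup>2 * w x"
    if "norm x < M" for x b
    using frechet_derivative_plane_wave_open[where X = "ball 0 M" and x = x and b = b
        and w = "\<lambda>y. frechet_derivative w (at y) b", OF open_ball _ fd] eq[of x] that
    by (simp add: power2_eq_square)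
  ultimately show thesis
    using that[of w] smooth_w \<eta>_bounds eq by (simp add: smooth_compact_def w_def)
qed

section \<open>The space-time reduction\<close>

lemma test_function_product:
  fixes w :: "'a::euclidean_space \<Rightarrow> real"
  assumes w: "smooth_compact w" and h: "smooth h" "\<And>s. s \<ge> t1 \<Longrightarrow> h s = 0" and t1: "t1 < T"
  shows "test_function T (\<lambda>z. w (fst z) * h (snd z))"
proof -
  have "smooth (\<lambda>z :: 'a \<times> real. w (fst z + 0))" "smooth (\<lambda>z :: 'a \<times> real. h (snd z + 0))"
    using w smooth_compose_affine[OF _ bounded_linear_fst, of w 0]
      smooth_compose_affine[OF h(1) bounded_linear_snd, of 0] by (simp_all add: smooth_compact_def)
  then have s: "smooth (\<lambda>z :: 'a \<times> real. w (fst z) * h (snd z))"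
    by (intro smooth_mult) simp_all
  define S where "S = {z \<in> UNIV \<times> {0..<T}. w (fst z) * h (snd z) \<noteq> 0}"
  have "S \<subseteq> supp w \<times> {0..t1}"
    unfolding S_def using supp_vanish[of _ w] h(2) by (force simp: not_le[symmetric])
  moreover have c: "compact (supp w \<times> {0..t1})"
    using w by (intro compact_Times) (simp_all add: smooth_compact_def)
  ultimately have sub: "closure S \<subseteq> supp w \<times> {0..t1}"
    using closure_minimal compact_imp_closed by blast
  then have "compact (closure S)"
    using bounded_subset[OF compact_imp_bounded[OF c]] by (simp add: compact_eq_bounded_closed)
  moreover have "closure S \<subseteq> UNIV \<times> {0..<T}" using sub t1 by fastforce
  ultimately show ?thesis using s unfolding test_function_def S_def Let_def by simp
qed

text \<open>Each partial derivative of \<open>w\<close> is itself an admissible test function for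
  the weak gradient of \<open>z\<close>. Second derivatives of \<open>w\<close> are known only for
  \<open>norm x < M\<close>, but elsewhere \<open>z\<close> vanishes. The total is
  \<open>l\<^sup>2\<close> because \<open>e\<close> is a unit vector.\<close>

lemma weak_grad_plane_wave:
  fixes e :: "'a::euclidean_space" and z :: "'a \<Rightarrow> real"
  assumes z: "H1 z" and e: "e \<in> Basis" and w: "smooth_compact w"
    and w2: "\<And>x b. norm x < M \<Longrightarrow>
      frechet_derivative (\<lambda>y. frechet_derivative w (at y) b) (at x) b = (l * (b \<bullet> e))\<^sup>2 * w x"
    and z0: "AE x in lebesgue. M \<le> norm x \<longrightarrow> z x = 0"
  shows "integrable lebesgue (\<lambda>x. weak_grad z x \<bullet> grad w x)"
    and "(LINT x|lebesgue. weak_grad z x \<bullet> grad w x) = - l\<^sup>2 * (LINT x|lebesgue. z x * w x)"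
proof -
  define W where "W = weak_grad z"
  have W: "is_weak_grad z W"
    using z unfolding H1_def W_def weak_grad_def by (metis someI_ex)
  have sw: "smooth w" and cw: "compact (supp w)" using w by (simp_all add: smooth_compact_def)
  have fd: "smooth_compact (\<lambda>x. frechet_derivative w (at x) b)" for b
  proof -
    have "frechet_derivative w (at x) b = 0" if "x \<notin> supp w" for x
    proof -
      have "(w has_derivative (\<lambda>_. 0)) (at x)"
        by (rule has_derivative_transform_within_open[of "\<lambda>_. 0" _ _ _ "- supp w"])
           (use that compact_imp_closed[OF cw] in \<open>auto simp: supp_vanish open_Compl\<close>)
      from fun_cong[OF frechet_derivative_at[OF this], of b] show ?thesis by simp
    qed
    then have "{x. frechet_derivative w (at x) b \<noteq> 0} \<subseteq> supp w" by blast
    then have "supp (\<lambda>x. frechet_derivative w (at x) b) \<subseteq> supp w"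
      unfolding supp_def[of "\<lambda>x. frechet_derivative w (at x) b"]
      using cw by (intro closure_minimal compact_imp_closed)
    then have "compact (supp (\<lambda>x. frechet_derivative w (at x) b))"
      using bounded_subset[OF compact_imp_bounded[OF cw]]
      by (simp add: supp_def compact_eq_bounded_closed)
    then show ?thesis using smooth_frechet_derivative[OF sw] by (simp add: smooth_compact_def)
  qed
  have L2w: "L2 w" if "smooth_compact w" for w :: "'a \<Rightarrow> real"
    using that by (intro L2_continuous_compact_supp) (simp_all add: smooth_compact_def smooth_imp_continuous)
  have L2z: "L2 z" and L2W: "L2 W" using z W by (simp_all add: H1_def is_weak_grad_def)
  have inner: "W x \<bullet> grad w x = (\<Sum>b\<in>Basis. (W x \<bullet> b) * frechet_derivative w (at x) b)" for x
    by (simp add: grad_def inner_sum_right mult.commute)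
  have int: "integrable lebesgue (\<lambda>x. (W x \<bullet> b) * frechet_derivative w (at x) b)" for b
    by (intro integrable_L2_mult L2_inner_component L2W L2w fd)
  show "integrable lebesgue (\<lambda>x. weak_grad z x \<bullet> grad w x)"
    unfolding W_def[symmetric] inner using int by simp
  have "(LINT x|lebesgue. W x \<bullet> grad w x) = (\<Sum>b\<in>Basis. LINT x|lebesgue. (W x \<bullet> b) * frechet_derivative w (at x) b)"
    unfolding inner using int by (rule Bochner_Integration.integral_sum)
  also have "\<dots> = (\<Sum>b\<in>Basis. - ((l * (b \<bullet> e))\<^sup>2 * (LINT x|lebesgue. z x * w x)))"
  proof (rule sum.cong[OF refl])
    fix b :: 'a assume b: "b \<in> Basis"
    have fd2: "smooth (\<lambda>x. frechet_derivative (\<lambda>y. frechet_derivative w (at y) b) (at x) b)"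
      by (intro smooth_frechet_derivative sw)
    have zm: "z \<in> borel_measurable lebesgue" "w \<in> borel_measurable lebesgue"
      using L2z L2w[OF w] by (simp_all add: L2_def)
    have "(LINT x|lebesgue. z x * frechet_derivative (\<lambda>y. frechet_derivative w (at y) b) (at x) b)
        = (LINT x|lebesgue. (l * (b \<bullet> e))\<^sup>2 * (z x * w x))"
    proof (rule integral_cong_AE)
      show "(\<lambda>x. z x * frechet_derivative (\<lambda>y. frechet_derivative w (at y) b) (at x) b) \<in> borel_measurable lebesgue"
        using borel_measurable_continuous_onI[OF smooth_imp_continuous[OF fd2]]
        by (intro borel_measurable_times zm(1) measurable_completion) simp
      show "(\<lambda>x. (l * (b \<bullet> e))\<^sup>2 * (z x * w x)) \<in> borel_measurable lebesgue"
        by (intro borel_measurable_times borel_measurable_const zm)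
      show "AE x in lebesgue. z x * frechet_derivative (\<lambda>y. frechet_derivative w (at y) b) (at x) b
          = (l * (b \<bullet> e))\<^sup>2 * (z x * w x)"
        using z0
      proof eventually_elim
        case (elim x)
        then show ?case using w2[of x b] by (cases "norm x < M") auto
      qed
    qed
    moreover have "(LINT x|lebesgue. z x * frechet_derivative (\<lambda>y. frechet_derivative w (at y) b) (at x) b)
        = - (LINT x|lebesgue. (W x \<bullet> b) * frechet_derivative w (at x) b)"
      using W fd b unfolding is_weak_grad_def by blast
    ultimately show "(LINT x|lebesgue. (W x \<bullet> b) * frechet_derivative w (at x) b)
        = - ((l * (b \<bullet> e))\<^sup>2 * (LINT x|lebesgue. z x * w x))"
      by simp
  qed
  also have "\<dots> = - l\<^sup>2 * (LINT x|lebesgue. z x * w x) * (\<Sum>b\<in>Basis. (b \<bullet> e)\<^sup>2)"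
    by (simp add: sum_distrib_left power_mult_distrib sum_negf algebra_simps)
  also have "(\<Sum>b\<in>Basis. (b \<bullet> e)\<^sup>2) = (1 :: real)"
  proof -
    have "(\<Sum>b\<in>Basis. (b \<bullet> e)\<^sup>2) = (\<Sum>b\<in>Basis. if b = e then 1 else (0::real))"
      using e by (intro sum.cong) (auto simp: inner_Basis)
    then show ?thesis using e by simp
  qed
  finally show "(LINT x|lebesgue. weak_grad z x \<bullet> grad w x) = - l\<^sup>2 * (LINT x|lebesgue. z x * w x)"
    by (simp add: W_def)
qed

section \<open>Lower bound for the nonlinear term\<close>

lemma powr_ge_tangent:
  fixes p \<mu> y :: real
  assumes p: "1 < p" and \<mu>: "0 < \<mu>" and y: "0 \<le> y"
  shows "p * \<mu> powr (p - 1) * y - (p - 1) * \<mu> powr p \<le> y powr p"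
proof (cases "y = 0")
  case False
  then have y: "0 < y" using y by simp
  \<comment> \<open>Convexity enters as Young's inequality for \<open>y powr p\<close> and
    \<open>\<mu> powr p\<close>, with weights \<open>1 / p\<close> and
    \<open>1 - 1 / p\<close>.\<close>
  have "(y powr p) powr (1 / p) * (\<mu> powr p) powr (1 - 1 / p) \<le> 1 / p * y powr p + (1 - 1 / p) * \<mu> powr p"
    using p y \<mu> by (intro Youngs_inequality_0) auto
  moreover have "p * (1 - 1 / p) = p - 1" using p by (simp add: field_simps)
  ultimately have "y * \<mu> powr (p - 1) \<le> 1 / p * y powr p + (1 - 1 / p) * \<mu> powr p"
    using p y by (simp add: powr_powr)
  then have "p * (y * \<mu> powr (p - 1)) \<le> p * (1 / p * y powr p + (1 - 1 / p) * \<mu> powr p)"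
    using p by (intro mult_left_mono) auto
  also have "\<dots> = y powr p + (p - 1) * \<mu> powr p" using p by (simp add: field_simps)
  finally show ?thesis by (simp add: algebra_simps)
qed (use p in simp)

text \<open>Hoelder's inequality in disguise: instead of dividing by norms, integrate the tangent line to
  \<open>y powr p\<close> at the point \<open>\<mu> = (LINT x|lebesgue. z x * w x) / K\<close>.\<close>

lemma nonlinear_pairing_lower_bound:
  fixes G :: "real \<Rightarrow> real" and z w :: "'a::euclidean_space \<Rightarrow> real"
  assumes p: "1 < p" and b: "0 < b" and G: "\<And>\<sigma>. G \<sigma> \<ge> b * \<bar>\<sigma>\<bar> powr p"
    and int: "integrable lebesgue (\<lambda>x. G (z x) * w x)" "integrable lebesgue (\<lambda>x. z x * w x)"
      "integrable lebesgue (\<lambda>x. w x * indicator X x)"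
    and w: "\<And>x. 0 \<le> w x" and z0: "AE x in lebesgue. x \<notin> X \<longrightarrow> z x = 0"
    and K: "(LINT x|lebesgue. w x * indicator X x) \<le> K" "0 < K"
    and pos: "0 < (LINT x|lebesgue. z x * w x)"
  shows "b * K powr (1 - p) * (LINT x|lebesgue. z x * w x) powr p \<le> (LINT x|lebesgue. G (z x) * w x)"
proof -
  define B where "B = (LINT x|lebesgue. z x * w x)"
  define \<mu> where "\<mu> = B / K"
  have B: "0 < B" using pos by (simp add: B_def)
  then have \<mu>: "0 < \<mu>" using K by (simp add: \<mu>_def)
  \<comment> \<open>\<open>c * y - d\<close> is \<open>b\<close> times the tangent line. Since
    \<open>\<mu> * K = B\<close>, integrating it gives \<open>b * (p * \<mu> powr (p - 1) * B - (p -
    1) * \<mu> powr p * K)\<close>, which collapses to \<open>b * \<mu> powr (p - 1) * B\<close>;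
    this choice of \<open>\<mu>\<close> is the optimal one.\<close>
  define c d where "c = b * (p * \<mu> powr (p - 1))" and "d = b * ((p - 1) * \<mu> powr p)"
  have cd: "0 \<le> c" "0 \<le> d" using b p by (simp_all add: c_def d_def)
  have "b * K powr (1 - p) * B powr p = b * (\<mu> powr (p - 1) * B)"
    using B K(2) by (simp add: \<mu>_def powr_divide powr_diff field_simps)
  also have "\<dots> = c * B - d * K"
    using \<mu> K(2) B by (simp add: c_def d_def \<mu>_def powr_diff field_simps)
  also have "\<dots> \<le> c * B - d * (LINT x|lebesgue. w x * indicator X x)"
    using K(1) cd by (simp add: mult_left_mono)
  also have "\<dots> = (LINT x|lebesgue. c * (z x * w x) - d * (w x * indicator X x))"
    using int by (simp add: B_def)
  also have "\<dots> \<le> (LINT x|lebesgue. G (z x) * w x)"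
  proof (rule integral_mono_AE)
    show "integrable lebesgue (\<lambda>x. c * (z x * w x) - d * (w x * indicator X x))" using int by simp
    show "AE x in lebesgue. c * (z x * w x) - d * (w x * indicator X x) \<le> G (z x) * w x"
      using z0
    proof eventually_elim
      case (elim x)
      show ?case
      \<comment> \<open>The constant term of the tangent line is charged on \<open>X\<close> only,
        so the mass of \<open>w\<close> outside \<open>X\<close> never enters; there
        \<open>z\<close> vanishes and nonnegativity of \<open>G\<close> is enough.\<close>
      proof (cases "x \<in> X")
        case True
        have "c * z x - d \<le> c * \<bar>z x\<bar> - d" using cd by (simp add: mult_left_mono)
        also have "\<dots> = b * (p * \<mu> powr (p - 1) * \<bar>z x\<bar> - (p - 1) * \<mu> powr p)"
          by (simp add: c_def d_def algebra_simps)
        also have "\<dots> \<le> b * \<bar>z x\<bar> powr p"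
          using powr_ge_tangent[OF p \<mu>, of "\<bar>z x\<bar>"] b by (intro mult_left_mono) auto
        also have "\<dots> \<le> G (z x)" by (rule G)
        finally have "(c * z x - d) * w x \<le> G (z x) * w x" using w by (intro mult_right_mono) auto
        then show ?thesis using True by (simp add: algebra_simps)
      next
        case False
        have "0 \<le> G (z x)" using G[of "z x"] b by (smt (verit) mult_nonneg_nonneg powr_ge_zero)
        then show ?thesis using False elim w by simp
      qed
    qed
  qed (rule int(1))
  finally show ?thesis by (simp add: B_def)
qed

text \<open>Product test functions \<open>w x * h s\<close> turn the space-time identity into the
  weak form of \<open>U'' = l\<^sup>2 * U + A\<close>. Only space derivatives are moved onto
  \<open>w\<close>; in time a single derivative of \<open>h\<close> appears, as in the definition of
  weak solutions.\<close>

lemma weak_solution_separated: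
  fixes e :: "'a::euclidean_space"
  assumes H1u: "\<And>s. s \<in> {0..<T} \<Longrightarrow> H1 (u s)" and L2v: "\<And>s. s \<in> {0..<T} \<Longrightarrow> L2 (v s)"
    and weak: "\<And>\<psi>. test_function T \<psi> \<Longrightarrow>
      \<epsilon> * (LINT x|lebesgue. g x * \<psi> (x, 0))
        + (LINT t|lebesgue_on {0<..<T}. LINT x|lebesgue. G (v t x) * \<psi> (x, t))
      = (LINT t|lebesgue_on {0<..<T}. LINT x|lebesgue.
           - v t x * deriv (\<lambda>s. \<psi> (x, s)) t + weak_grad (u t) x \<bullet> grad (\<lambda>y. \<psi> (y, t)) x)"
    and u0: "\<And>s. s \<in> {0..<T} \<Longrightarrow> AE x in lebesgue. M \<le> norm x \<longrightarrow> u s x = 0"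
    and e: "e \<in> Basis" and w: "smooth_compact w"
    and w2: "\<And>x b. norm x < M \<Longrightarrow>
      frechet_derivative (\<lambda>y. frechet_derivative w (at y) b) (at x) b = (l * (b \<bullet> e))\<^sup>2 * w x"
    and h: "smooth h" "t1 < T" "\<And>s. s \<ge> t1 \<Longrightarrow> h s = 0"
  shows "\<epsilon> * (LINT x|lebesgue. g x * w x) * h 0
      + (LINT s|lebesgue_on {0<..<T}. (LINT x|lebesgue. G (v s x) * w x) * h s)
    = (LINT s|lebesgue_on {0<..<T}. - (LINT x|lebesgue. v s x * w x) * deriv h s
        - l\<^sup>2 * (LINT x|lebesgue. u s x * w x) * h s)"
proof -
  have sw: "smooth w" and cw: "compact (supp w)" using w by (simp_all add: smooth_compact_def)
  have L2w: "L2 w" by (intro L2_continuous_compact_supp smooth_imp_continuous sw cw)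
  have dh: "deriv (\<lambda>s. c * h s) t = c * deriv h t" for c t
    using smooth_imp_differentiable[OF h(1)]
    by (intro deriv_cmult) (simp add: field_differentiable_def real_differentiable_def)
  have gw: "grad (\<lambda>y. w y * c) x = c *\<^sub>R grad w x" for c x
  proof -
    have "(w has_derivative frechet_derivative w (at x)) (at x)"
      using smooth_imp_differentiable[OF sw] by (simp add: frechet_derivative_works)
    then have "((\<lambda>y. w y * c) has_derivative (\<lambda>b. frechet_derivative w (at x) b * c)) (at x)"
      by (rule has_derivative_mult_left)
    from fun_cong[OF frechet_derivative_at[OF this]] show ?thesis
      by (simp add: grad_def scaleR_sum_right mult.commute)
  qed
  have "(LINT x|lebesgue. - v t x * deriv (\<lambda>s. w x * h s) t + weak_grad (u t) x \<bullet> grad (\<lambda>y. w y * h t) x)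
      = - (LINT x|lebesgue. v t x * w x) * deriv h t - l\<^sup>2 * (LINT x|lebesgue. u t x * w x) * h t"
    if t: "t \<in> {0<..<T}" for t
  proof -
    have t': "t \<in> {0..<T}" using t by simp
    note wg = weak_grad_plane_wave[OF H1u[OF t'] e w w2 u0[OF t']]
    have "(LINT x|lebesgue. - v t x * deriv (\<lambda>s. w x * h s) t + weak_grad (u t) x \<bullet> grad (\<lambda>y. w y * h t) x)
        = (LINT x|lebesgue. (- deriv h t) * (v t x * w x) + h t * (weak_grad (u t) x \<bullet> grad w x))"
      by (rule Bochner_Integration.integral_cong) (simp_all add: dh gw)
    also have "\<dots> = (- deriv h t) * (LINT x|lebesgue. v t x * w x)
        + h t * (LINT x|lebesgue. weak_grad (u t) x \<bullet> grad w x)"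
      using wg(1) integrable_L2_mult[OF L2v[OF t'] L2w] by simp
    finally show ?thesis by (simp add: wg(2))
  qed
  then have r: "(LINT t|lebesgue_on {0<..<T}. LINT x|lebesgue.
      - v t x * deriv (\<lambda>s. w x * h s) t + weak_grad (u t) x \<bullet> grad (\<lambda>y. w y * h t) x)
    = (LINT s|lebesgue_on {0<..<T}. - (LINT x|lebesgue. v s x * w x) * deriv h s
        - l\<^sup>2 * (LINT x|lebesgue. u s x * w x) * h s)"
    by (intro Bochner_Integration.integral_cong) simp_all
  have "(LINT x|lebesgue. g x * (w x * h 0)) = (LINT x|lebesgue. g x * w x) * h 0"
    "(LINT x|lebesgue. G (v t x) * (w x * h t)) = (LINT x|lebesgue. G (v t x) * w x) * h t" for t
    by (simp_all flip: mult.assoc)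
  then show ?thesis
    using weak[OF test_function_product[OF w h(1,3,2)]] r by (simp add: mult.assoc)
qed

text \<open>The bound of \<open>plane_wave_ball_integral\<close> at radius \<open>r + 1\<close>, the
  radius relevant at time 0. Later times factor out through
  \<open>r + s + 1 \<le> (r + 1) * (1 + s)\<close>.\<close>

definition wave_const :: "nat \<Rightarrow> real \<Rightarrow> real \<Rightarrow> real" where
  "wave_const N l r = exp (l * (r + 1)) * (2 / l * sqrt (pi / (l / (4 * (r + 1)))) ^ (N - 1))"

lemma wave_const_pos: "0 < l \<Longrightarrow> 0 \<le> r \<Longrightarrow> 0 < wave_const N l r"
  by (simp add: wave_const_def)

lemma plane_wave_ball_growth:
  fixes e :: "'a::euclidean_space"
  assumes e: "e \<in> Basis" and l: "0 < l" and r: "0 \<le> r" and s: "0 \<le> s"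
  shows "(LINT x|lebesgue. exp (l * (x \<bullet> e)) * indicator (cball 0 (r + s + 1)) x)
    \<le> wave_const DIM('a) l r * (1 + s) powr ((real DIM('a) - 1) / 2) * exp (l * s)"
proof -
  have "sqrt (pi / (l / (4 * (r + s + 1)))) \<le> sqrt (pi / (l / (4 * (r + 1))) * (1 + s))"
  proof (rule real_sqrt_le_mono)
    have "r + s + 1 \<le> (r + 1) * (1 + s)" using r s by (simp add: algebra_simps)
    then have "4 * pi / l * (r + s + 1) \<le> 4 * pi / l * ((r + 1) * (1 + s))"
      using l by (intro mult_left_mono) auto
    then show "pi / (l / (4 * (r + s + 1))) \<le> pi / (l / (4 * (r + 1))) * (1 + s)"
      using l by (simp add: field_simps)
  qed
  also have "\<dots> = sqrt (pi / (l / (4 * (r + 1)))) * sqrt (1 + s)" by (rule real_sqrt_mult)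
  finally have "sqrt (pi / (l / (4 * (r + s + 1)))) ^ (DIM('a) - 1)
      \<le> (sqrt (pi / (l / (4 * (r + 1)))) * sqrt (1 + s)) ^ (DIM('a) - 1)"
    using l r s by (intro power_mono) auto
  also have "\<dots> = sqrt (pi / (l / (4 * (r + 1)))) ^ (DIM('a) - 1) * sqrt (1 + s) ^ (DIM('a) - 1)"
    by (rule power_mult_distrib)
  also have "sqrt (1 + s) ^ (DIM('a) - 1) = (1 + s) powr ((real DIM('a) - 1) / 2)"
  proof -
    have n: "real (DIM('a) - 1) = real DIM('a) - 1"
      using DIM_positive[where 'a = 'a] by (simp add: of_nat_diff Suc_leI)
    have "sqrt (1 + s) ^ (DIM('a) - 1) = sqrt (1 + s) powr real (DIM('a) - 1)"
      using s by (intro powr_realpow[symmetric]) simp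
    also have "\<dots> = ((1 + s) powr (1 / 2)) powr real (DIM('a) - 1)" using s by (simp add: powr_half_sqrt)
    also have "((1 + s) powr (1 / 2)) powr real (DIM('a) - 1) = (1 + s) powr ((real DIM('a) - 1) / 2)"
      unfolding n powr_powr by simp
    finally show ?thesis .
  qed
  finally have q: "sqrt (pi / (l / (4 * (r + s + 1)))) ^ (DIM('a) - 1)
      \<le> sqrt (pi / (l / (4 * (r + 1)))) ^ (DIM('a) - 1) * (1 + s) powr ((real DIM('a) - 1) / 2)" .
  have "(LINT x|lebesgue. exp (l * (x \<bullet> e)) * indicator (cball 0 (r + s + 1)) x)
      \<le> exp (l * (r + s + 1)) * (2 / l * sqrt (pi / (l / (4 * (r + s + 1)))) ^ (DIM('a) - 1))"
    using r s by (intro plane_wave_ball_integral[OF e l]) simp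
  also have "\<dots> \<le> exp (l * (r + s + 1)) * (2 / l *
      (sqrt (pi / (l / (4 * (r + 1)))) ^ (DIM('a) - 1) * (1 + s) powr ((real DIM('a) - 1) / 2)))"
    using q l by (intro mult_left_mono) auto
  also have "exp (l * (r + s + 1)) = exp (l * (r + 1)) * exp (l * s)"
    by (simp add: algebra_simps flip: exp_add)
  finally show ?thesis by (simp add: wave_const_def mult_ac)
qed

text \<open>Here the equation in space and time becomes the scalar problem. The truncated wave and
  its supremum depend on \<open>T\<close>, yet the result involves only \<open>l\<close>,
  \<open>r\<close>, \<open>b\<close>, \<open>p\<close>, the dimension, \<open>\<epsilon>\<close> and
  \<open>c0\<close>.\<close>

lemma weak_solution_lifespan_integral:
  fixes e :: "'a::euclidean_space" and G :: "real \<Rightarrow> real"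
  assumes p: "1 < p" and b: "0 < b" and G: "continuous_on UNIV G" "\<And>\<sigma>. G \<sigma> \<ge> b * \<bar>\<sigma>\<bar> powr p"
    and f: "smooth_compact f" and g: "smooth_compact g"
    and e: "e \<in> Basis" and l: "0 < l" and r: "0 \<le> r" and \<epsilon>: "0 < \<epsilon>" and c0: "0 < c0"
    and init: "c0 \<le> (LINT x|lebesgue. (g x + l * f x) * exp (l * (x \<bullet> e)))"
      "0 \<le> (LINT x|lebesgue. (g x - l * f x) * exp (l * (x \<bullet> e)))"
    and sol: "weak_solution G f g \<epsilon> T u"
    and cone: "spacetime_supp T u \<subseteq> {(x, t). t \<in> {0..T} \<and> norm x \<le> r + t}"
    and t: "0 \<le> t" "t < T"
  shows "(p - 1) * (b * wave_const DIM('a) l r powr (1 - p) / 2)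
      * integral {0..t} (\<lambda>s. (1 + s) powr (- ((real DIM('a) - 1) * (p - 1) / 2)))
    \<le> (\<epsilon> * c0 / 2) powr (1 - p)"
proof -
  obtain v where v: "C1_into_L2_with_deriv {0..<T} u v" "L1_L1 {0<..<T} (\<lambda>t x. G (v t x))"
      "AE x in lebesgue. u 0 x = \<epsilon> * f x" "AE x in lebesgue. v 0 x = \<epsilon> * g x"
    and weak: "\<And>\<psi>. test_function T \<psi> \<Longrightarrow>
      \<epsilon> * (LINT x|lebesgue. g x * \<psi> (x, 0))
        + (LINT t|lebesgue_on {0<..<T}. LINT x|lebesgue. G (v t x) * \<psi> (x, t))
      = (LINT t|lebesgue_on {0<..<T}. LINT x|lebesgue.
           - v t x * deriv (\<lambda>s. \<psi> (x, s)) t + weak_grad (u t) x \<bullet> grad (\<lambda>y. \<psi> (y, t)) x)"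
    using sol unfolding weak_solution_def by blast
  have T: "0 < T" using t by simp
  have H1u: "H1 (u s)" if "s \<in> {0..<T}" for s
    using sol that unfolding weak_solution_def continuous_into_H1_def by blast
  have L2u: "L2 (u s)" and L2v: "L2 (v s)" if "s \<in> {0..<T}" for s
    using v(1) that unfolding C1_into_L2_with_deriv_def continuous_into_L2_def by blast+
  note u_cone = spacetime_supp_cone_AE[OF cone]
  have v_cone: "AE x in lebesgue. r + s + 1 < norm x \<longrightarrow> v s x = 0" if "s \<in> {0..<T}" for s
    by (rule time_derivative_vanishes_AE[OF v(1) u_cone that])
  obtain M0 where M0: "\<And>x. x \<in> supp f \<union> supp g \<Longrightarrow> norm x \<le> M0"
  proof -
    have "bounded (supp f \<union> supp g)"
      using f g by (simp add: smooth_compact_def compact_imp_bounded)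
    then show ?thesis using that unfolding bounded_iff by blast
  qed
  \<comment> \<open>The first entry puts the support of every \<open>u s\<close> inside the region
    where the wave is intact, the second does so for the data, whose pairings are then those with
    the full exponential.\<close>
  define M where "M = max (r + T + 1) (M0 + 1)"
  obtain w :: "'a \<Rightarrow> real" where w: "smooth_compact w" "\<And>x. 0 \<le> w x" "\<And>x. w x \<le> exp (l * (x \<bullet> e))"
    "\<And>x. norm x < M \<Longrightarrow> w x = exp (l * (x \<bullet> e))"
    "\<And>x b. norm x < M \<Longrightarrow>
      frechet_derivative (\<lambda>y. frechet_derivative w (at y) b) (at x) b = (l * (b \<bullet> e))\<^sup>2 * w x"
    using truncated_plane_wave by blast
  have L2_sc: "L2 z" if "smooth_compact z" for z :: "'a \<Rightarrow> real"
    using that by (intro L2_continuous_compact_supp) (simp_all add: smooth_compact_def smooth_imp_continuous)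
  note L2w = L2_sc[OF w(1)]
  have w_meas: "w \<in> borel_measurable lebesgue" using L2w by (simp add: L2_def)
  obtain cw where cw: "\<And>x. \<bar>w x\<bar> \<le> cw"
  proof -
    have "bounded (w ` supp w)"
      using w(1) unfolding smooth_compact_def
      by (intro compact_imp_bounded compact_continuous_image smooth_imp_continuous) auto
    then obtain cw where "\<And>x. x \<in> supp w \<Longrightarrow> \<bar>w x\<bar> \<le> cw" unfolding bounded_iff by auto
    then have "\<bar>w x\<bar> \<le> max cw 0" for x
      using supp_vanish[of x w] by (cases "x \<in> supp w") (auto simp: le_max_iff_disj)
    then show ?thesis using that by blast
  qed
  define A where "A s = (LINT x|lebesgue. G (v s x) * w x)" for s
  define B where "B s = (LINT x|lebesgue. v s x * w x)" for s
  define U where "U s = (LINT x|lebesgue. u s x * w x)" for s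
  have data: "(LINT x|lebesgue. z x * w x) = (LINT x|lebesgue. z x * exp (l * (x \<bullet> e)))"
    "integrable lebesgue (\<lambda>x. z x * exp (l * (x \<bullet> e)))"
    if "smooth_compact z" "supp z \<subseteq> supp f \<union> supp g" for z
  proof -
    have eq: "z x * w x = z x * exp (l * (x \<bullet> e))" for x
    proof (cases "x \<in> supp z")
      case True
      then have "norm x \<le> M0" using that(2) M0 by blast
      then show ?thesis using w(4)[of x] by (simp add: M_def)
    qed (simp add: supp_vanish)
    show "(LINT x|lebesgue. z x * w x) = (LINT x|lebesgue. z x * exp (l * (x \<bullet> e)))"
      by (simp only: eq)
    show "integrable lebesgue (\<lambda>x. z x * exp (l * (x \<bullet> e)))"
      using integrable_L2_mult[OF L2_sc[OF that(1)] L2w] by (simp only: eq)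
  qed
  have B0: "B 0 = \<epsilon> * (LINT x|lebesgue. g x * exp (l * (x \<bullet> e)))"
  proof -
    have "B 0 = (LINT x|lebesgue. \<epsilon> * (g x * w x))"
      unfolding B_def
    proof (rule integral_cong_AE)
      show "(\<lambda>x. v 0 x * w x) \<in> borel_measurable lebesgue" "(\<lambda>x. \<epsilon> * (g x * w x)) \<in> borel_measurable lebesgue"
        using L2v[of 0] T L2_sc[OF g] w_meas by (auto simp: L2_def intro!: borel_measurable_times)
      show "AE x in lebesgue. v 0 x * w x = \<epsilon> * (g x * w x)"
        using v(4) by eventually_elim simp
    qed
    then show ?thesis using data(1)[OF g] by simp
  qed
  have U0: "U 0 = \<epsilon> * (LINT x|lebesgue. f x * exp (l * (x \<bullet> e)))"
  proof -
    have "U 0 = (LINT x|lebesgue. \<epsilon> * (f x * w x))"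
      unfolding U_def
    proof (rule integral_cong_AE)
      show "(\<lambda>x. u 0 x * w x) \<in> borel_measurable lebesgue" "(\<lambda>x. \<epsilon> * (f x * w x)) \<in> borel_measurable lebesgue"
        using L2u[of 0] T L2_sc[OF f] w_meas by (auto simp: L2_def intro!: borel_measurable_times)
      show "AE x in lebesgue. u 0 x * w x = \<epsilon> * (f x * w x)"
        using v(3) by eventually_elim simp
    qed
    then show ?thesis using data(1)[OF f] by simp
  qed
  have lin: "(LINT x|lebesgue. (g x + c * f x) * exp (l * (x \<bullet> e)))
      = (LINT x|lebesgue. g x * exp (l * (x \<bullet> e))) + c * (LINT x|lebesgue. f x * exp (l * (x \<bullet> e)))" for c
    using data(2)[OF g] data(2)[OF f] by (simp add: distrib_right mult.assoc)
  have "c0 \<le> (LINT x|lebesgue. g x * exp (l * (x \<bullet> e))) + l * (LINT x|lebesgue. f x * exp (l * (x \<bullet> e)))"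
    using init(1) unfolding lin .
  then have init_plus: "\<epsilon> * c0 \<le> B 0 + l * U 0"
    using mult_left_mono[of _ _ \<epsilon>] \<epsilon> by (fastforce simp: B0 U0 algebra_simps)
  have "0 \<le> (LINT x|lebesgue. g x * exp (l * (x \<bullet> e))) - l * (LINT x|lebesgue. f x * exp (l * (x \<bullet> e)))"
    using init(2) lin[of "- l"] by simp
  then have init_minus: "0 \<le> B 0 - l * U 0"
    using mult_left_mono[of _ _ \<epsilon>] \<epsilon> by (fastforce simp: B0 U0 algebra_simps)
  define \<kappa> where "\<kappa> = (real DIM('a) - 1) * (p - 1) / 2"
  define K where "K s = wave_const DIM('a) l r * (1 + s) powr ((real DIM('a) - 1) / 2) * exp (l * s)" for s
  define c where "c = b * wave_const DIM('a) l r powr (1 - p)"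
  have c_pos: "0 < c" using b wave_const_pos[OF l r, of "DIM('a)"] by (simp add: c_def)
  show ?thesis
    unfolding \<kappa>_def[symmetric] c_def[symmetric]
  proof (rule lifespan_integral_bound[OF p l _ c_pos t, of "\<epsilon> * c0" B U A])
    show "0 < \<epsilon> * c0" using \<epsilon> c0 by simp
    show "continuous_on {0..<T} B"
      unfolding B_def using v(1) L2w by (intro continuous_on_L2_pairing) (auto simp: C1_into_L2_with_deriv_def)
    show "(U has_real_derivative B s) (at s within {0..<T})" if "s \<in> {0..<T}" for s
      unfolding U_def B_def by (rule has_real_derivative_L2_pairing[OF v(1) L2w that])
    show "integrable (lebesgue_on {0<..<T}) A"
      unfolding A_def by (rule integrable_L1_pairing[OF v(2) _ w_meas cw]) simp
    have "AE s in lebesgue_on {0<..<T}. integrable lebesgue (\<lambda>x. G (v s x))"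
      using v(2) unfolding L1_L1_def strongly_measurable_L1_def by blast
    then show "AE s in lebesgue_on {0<..<T}. 0 \<le> A s \<and>
        (0 < B s \<longrightarrow> c * (1 + s) powr - \<kappa> * exp (- l * (p - 1) * s) * B s powr p \<le> A s)"
      using AE_space
    proof eventually_elim
      case (elim s)
      then have s: "s \<in> {0..<T}" "0 \<le> s" by auto
      have G0: "0 \<le> G y" for y using order_trans[OF _ G(2)] b by simp
      have K_pos: "0 < K s" using wave_const_pos[OF l r] s by (simp add: K_def)
      have "0 \<le> A s" unfolding A_def using G0 w(2) by simp
      moreover have "c * (1 + s) powr - \<kappa> * exp (- l * (p - 1) * s) * B s powr p \<le> A s" if "0 < B s"
      proof -
        \<comment> \<open>The factor \<open>K s powr (1 - p)\<close> from the nonlinear bound is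
          where both weights originate: the algebraic growth of the mass becomes
          \<open>(1 + s) powr (- \<kappa>)\<close>, its exponential growth
          \<open>exp (- l * (p - 1) * s)\<close>.\<close>
        have "K s powr (1 - p) = wave_const DIM('a) l r powr (1 - p)
            * ((1 + s) powr ((real DIM('a) - 1) / 2)) powr (1 - p) * exp (l * s) powr (1 - p)"
          unfolding K_def using wave_const_pos[OF l r] by (simp add: powr_mult less_imp_le)
        also have "((1 + s) powr ((real DIM('a) - 1) / 2)) powr (1 - p) = (1 + s) powr - \<kappa>"
          unfolding powr_powr \<kappa>_def by (rule arg_cong2[where f = "(powr)"]) (simp_all add: field_simps)
        also have "exp (l * s) powr (1 - p) = exp (- l * (p - 1) * s)"
          by (simp add: powr_def algebra_simps)
        finally have "c * (1 + s) powr - \<kappa> * exp (- l * (p - 1) * s) * B s powr p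
            = b * K s powr (1 - p) * B s powr p"
          by (simp add: c_def mult_ac)
        also have "\<dots> \<le> A s"
          unfolding A_def B_def
        proof (rule nonlinear_pairing_lower_bound[OF p b G(2), where X = "cball 0 (r + s + 1)"])
          show "integrable lebesgue (\<lambda>x. G (v s x) * w x)"
            by (rule integrable_mult_bounded_lebesgue(1)[OF elim(1) w_meas cw])
          show "integrable lebesgue (\<lambda>x. v s x * w x)" by (rule integrable_L2_mult[OF L2v[OF s(1)] L2w])
          have "integrable lebesgue w"
            using w(1) by (intro integrable_continuous_compact_supp) (simp_all add: smooth_compact_def smooth_imp_continuous)
          then show wi: "integrable lebesgue (\<lambda>x. w x * indicator (cball 0 (r + s + 1)) x)"
            by (intro integrable_real_mult_indicator) auto
          show "AE x in lebesgue. x \<notin> cball 0 (r + s + 1) \<longrightarrow> v s x = 0"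
            using v_cone[OF s(1)] by eventually_elim auto
          have "integrable lborel (\<lambda>x::'a. indicator (cball 0 (r + s + 1)) x *\<^sub>R exp (l * (x \<bullet> e)))"
            by (intro borel_integrable_compact continuous_intros) simp
          then have "integrable lebesgue (\<lambda>x::'a. exp (l * (x \<bullet> e)) * indicator (cball 0 (r + s + 1)) x)"
            by (simp add: integrable_completion borel_measurable_integrable mult.commute)
          then have "(LINT x|lebesgue. w x * indicator (cball 0 (r + s + 1)) x)
              \<le> (LINT x|lebesgue. exp (l * (x \<bullet> e)) * indicator (cball 0 (r + s + 1)) x)"
            by (intro integral_mono wi mult_right_mono w(3)) auto
          also have "\<dots> \<le> K s" unfolding K_def by (rule plane_wave_ball_growth[OF e l r s(2)])
          finally show "(LINT x|lebesgue. w x * indicator (cball 0 (r + s + 1)) x) \<le> K s" .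
        qed (use w(2) K_pos that B_def in auto)
        finally show ?thesis .
      qed
      ultimately show ?case by simp
    qed
    fix h :: "real \<Rightarrow> real" and t1
    assume h: "smooth h" "0 < t1" "t1 < T" "\<And>s. s \<ge> t1 \<Longrightarrow> h s = 0"
    have "AE x in lebesgue. M \<le> norm x \<longrightarrow> u s x = 0" if "s \<in> {0..<T}" for s
      using u_cone[OF that] by eventually_elim (use that in \<open>auto simp: M_def\<close>)
    from weak_solution_separated[OF H1u L2v weak this e w(1,5) h(1,3,4)]
    show "B 0 * h 0 + (LINT s|lebesgue_on {0<..<T}. A s * h s)
        = (LINT s|lebesgue_on {0<..<T}. - B s * deriv h s - l\<^sup>2 * U s * h s)"
      using data(1)[OF g] unfolding A_def B_def[of s for s] U_def B0[unfolded B_def] by simp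
  qed (use init_plus init_minus in auto)
qed

text \<open>As \<open>l\<close> tends to 0 the wave tends to 1 and the contribution of
  \<open>f\<close> disappears, so both integrals tend to that of \<open>g\<close>, and one small
  \<open>l\<close> serves both signs. Restricting to \<open>l \<le> 1\<close> and to the compact
  supports provides a dominating function.\<close>

lemma low_frequency_data:
  fixes f g :: "'a::euclidean_space \<Rightarrow> real"
  assumes f: "smooth_compact f" and g: "smooth_compact g" and c: "c < (LINT x|lebesgue. g x)"
    and e: "e \<in> Basis"
  obtains l :: real where "0 < l"
    "c < (LINT x|lebesgue. (g x + l * f x) * exp (l * (x \<bullet> e)))"
    "c < (LINT x|lebesgue. (g x - l * f x) * exp (l * (x \<bullet> e)))"
proof -
  define l where "l n = inverse (real (Suc n))" for n
  have l: "0 < l n" "l n \<le> 1" for n by (simp_all add: l_def inverse_le_1_iff)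
  have l_lim: "l \<longlonglongrightarrow> 0" unfolding l_def by (rule LIMSEQ_inverse_real_of_nat)
  obtain M where M: "\<And>x. x \<in> supp f \<union> supp g \<Longrightarrow> norm x \<le> M"
  proof -
    have "bounded (supp f \<union> supp g)"
      using f g by (simp add: smooth_compact_def compact_imp_bounded)
    then show ?thesis using that unfolding bounded_iff by blast
  qed
  have cont: "continuous_on UNIV f" "continuous_on UNIV g"
    using f g by (simp_all add: smooth_compact_def smooth_imp_continuous)
  have int: "integrable lebesgue f" "integrable lebesgue g"
    using f g cont by (simp_all add: smooth_compact_def integrable_continuous_compact_supp)
  have meas: "z \<in> borel_measurable lebesgue" if "continuous_on UNIV z" for z :: "'a \<Rightarrow> real"
    using borel_measurable_continuous_onI[OF that] by (intro measurable_completion) simp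
  \<comment> \<open>The parameter \<open>s\<close> carries the sign and will be 1 and -1.\<close>
  have lim: "(\<lambda>n. LINT x|lebesgue. (g x + s * l n * f x) * exp (l n * (x \<bullet> e))) \<longlonglongrightarrow> (LINT x|lebesgue. g x)"
    if s: "\<bar>s\<bar> \<le> 1" for s
  proof (rule integral_dominated_convergence[where w = "\<lambda>x. (\<bar>g x\<bar> + \<bar>f x\<bar>) * exp M"])
    show "g \<in> borel_measurable lebesgue" by (rule meas[OF cont(2)])
    show "(\<lambda>x. (g x + s * l n * f x) * exp (l n * (x \<bullet> e))) \<in> borel_measurable lebesgue" for n
      by (intro meas continuous_intros cont)
    show "integrable lebesgue (\<lambda>x. (\<bar>g x\<bar> + \<bar>f x\<bar>) * exp M)" using int by simp
    show "AE x in lebesgue. (\<lambda>n. (g x + s * l n * f x) * exp (l n * (x \<bullet> e))) \<longlonglongrightarrow> g x"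
    proof (rule AE_I2)
      fix x :: 'a
      have "(\<lambda>n. (g x + s * l n * f x) * exp (l n * (x \<bullet> e))) \<longlonglongrightarrow> (g x + s * 0 * f x) * exp (0 * (x \<bullet> e))"
        by (intro tendsto_intros l_lim)
      then show "(\<lambda>n. (g x + s * l n * f x) * exp (l n * (x \<bullet> e))) \<longlonglongrightarrow> g x" by simp
    qed
    show "AE x in lebesgue. norm ((g x + s * l n * f x) * exp (l n * (x \<bullet> e))) \<le> (\<bar>g x\<bar> + \<bar>f x\<bar>) * exp M" for n
    proof (rule AE_I2)
      fix x :: 'a
      show "norm ((g x + s * l n * f x) * exp (l n * (x \<bullet> e))) \<le> (\<bar>g x\<bar> + \<bar>f x\<bar>) * exp M"
      proof (cases "x \<in> supp f \<union> supp g")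
        case True
        have "l n * (x \<bullet> e) \<le> l n * norm x"
          using l[of n] Basis_le_norm[OF e, of x] by (intro mult_left_mono) auto
        also have "\<dots> \<le> 1 * norm x" using l[of n] by (intro mult_right_mono) auto
        finally have "l n * (x \<bullet> e) \<le> norm x" by simp
        then have "exp (l n * (x \<bullet> e)) \<le> exp M" using M[OF True] by simp
        moreover have "\<bar>g x + s * l n * f x\<bar> \<le> \<bar>g x\<bar> + \<bar>f x\<bar>"
        proof -
          have "\<bar>s * l n\<bar> * \<bar>f x\<bar> \<le> 1 * \<bar>f x\<bar>"
            using s l[of n] by (intro mult_right_mono) (auto simp: abs_mult intro: mult_le_one)
          then show ?thesis using abs_triangle_ineq[of "g x" "s * l n * f x"] by (simp add: abs_mult)
        qed
        ultimately show ?thesis by (simp add: abs_mult mult_mono)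
      qed (simp add: supp_vanish)
    qed
  qed
  have "\<forall>\<^sub>F n in sequentially. c < (LINT x|lebesgue. (g x + 1 * l n * f x) * exp (l n * (x \<bullet> e))) \<and>
      c < (LINT x|lebesgue. (g x + (- 1) * l n * f x) * exp (l n * (x \<bullet> e)))"
    by (intro eventually_conj order_tendstoD(1)[OF lim c]) simp_all
  then obtain n where "c < (LINT x|lebesgue. (g x + 1 * l n * f x) * exp (l n * (x \<bullet> e)))"
      "c < (LINT x|lebesgue. (g x + (- 1) * l n * f x) * exp (l n * (x \<bullet> e)))"
    by (auto dest: eventually_happens)
  then show thesis using that[OF l(1)[of n]] by simp
qed

section \<open>From the integral bound to the lifespan\<close>

lemma lifespan_bound_subcritical:
  fixes T D \<epsilon> p \<kappa> :: real
  assumes p: "1 < p" and \<kappa>: "\<kappa> < 1" and D: "0 \<le> D" and \<epsilon>: "0 < \<epsilon>" "\<epsilon> \<le> 1"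
    and bound: "\<And>t. 0 \<le> t \<Longrightarrow> t < T \<Longrightarrow> integral {0..t} (\<lambda>s. (1 + s) powr (- \<kappa>)) \<le> D * \<epsilon> powr (1 - p)"
  shows "T \<le> (1 + (1 - \<kappa>) * D) powr (1 / (1 - \<kappa>)) * \<epsilon> powr (- ((p - 1) / (1 - \<kappa>)))"
\<comment> \<open>The integral bound is available only for times strictly before \<open>T\<close>,
  so \<open>T\<close> is reached as a supremum.\<close>
proof (rule dense_le)
  fix t assume t: "t < T"
  define X where "X = (1 + (1 - \<kappa>) * D) * \<epsilon> powr (1 - p)"
  have X: "(1 + (1 - \<kappa>) * D) powr (1 / (1 - \<kappa>)) * \<epsilon> powr (- ((p - 1) / (1 - \<kappa>))) = X powr (1 / (1 - \<kappa>))"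
    using D \<kappa> \<epsilon> by (simp add: X_def powr_mult powr_powr minus_divide_left)
  show "t \<le> (1 + (1 - \<kappa>) * D) powr (1 / (1 - \<kappa>)) * \<epsilon> powr (- ((p - 1) / (1 - \<kappa>)))"
  proof (cases "0 \<le> t")
    case True
    \<comment> \<open>The restriction \<open>\<epsilon> \<le> 1\<close> lets
      \<open>\<epsilon> powr (1 - p)\<close> absorb the additive 1 produced by the primitive; this
      is the 1 in the constant \<open>1 + (1 - \<kappa>) * D\<close>.\<close>
    have e1: "1 \<le> \<epsilon> powr (1 - p)"
      using powr_mono'[of "1 - p" 0 \<epsilon>] \<epsilon> p by simp
    have "((1 + t) powr (1 - \<kappa>) - 1) / (1 - \<kappa>) \<le> D * \<epsilon> powr (1 - p)"
      using bound[OF True t] integral_one_plus_powr[OF True, of \<kappa>] \<kappa> by simp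
    then have "(1 + t) powr (1 - \<kappa>) - 1 \<le> (D * \<epsilon> powr (1 - p)) * (1 - \<kappa>)"
      using \<kappa> by (simp add: pos_divide_le_eq)
    then have "(1 + t) powr (1 - \<kappa>) \<le> X" using e1 by (simp add: X_def algebra_simps)
    then have "((1 + t) powr (1 - \<kappa>)) powr (1 / (1 - \<kappa>)) \<le> X powr (1 / (1 - \<kappa>))"
      using \<kappa> by (intro powr_mono2) auto
    then show ?thesis unfolding X using True \<kappa> by (simp add: powr_powr)
  qed (simp add: order_trans[of t 0])
qed

lemma lifespan_bound_critical:
  fixes T D \<epsilon> p :: real
  assumes bound: "\<And>t. 0 \<le> t \<Longrightarrow> t < T \<Longrightarrow> integral {0..t} (\<lambda>s. (1 + s) powr (- 1)) \<le> D * \<epsilon> powr (1 - p)"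
  shows "T \<le> exp (D * \<epsilon> powr (- (p - 1)))"
proof (rule dense_le)
  fix t assume t: "t < T"
  show "t \<le> exp (D * \<epsilon> powr (- (p - 1)))"
  proof (cases "0 \<le> t")
    case True
    have "ln (1 + t) \<le> D * \<epsilon> powr (1 - p)"
      using bound[OF True t] integral_one_plus_powr_minus_one[OF True] by simp
    then have "exp (ln (1 + t)) \<le> exp (D * \<epsilon> powr (1 - p))" by (simp only: exp_le_cancel_iff)
    then have "1 + t \<le> exp (D * \<epsilon> powr (1 - p))" using True by simp
    then show ?thesis by simp
  qed (simp add: order_trans[of t 0])
qed

theorem proposition5p1:
  fixes p b :: real
    and G :: "real \<Rightarrow> real"
    and f g :: "real ^ 'n::finite \<Rightarrow> real"
    and N :: nat and r0 :: real
  defines "N \<equiv> CARD('n)"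
    and "r0 \<equiv> Sup (norm ` (supp f \<union> supp g))"
  assumes "p > 1" and "b > 0"
    and "G C1_differentiable_on UNIV" and "G 0 = 0"
    and "\<And>\<sigma>. G \<sigma> \<ge> b * \<bar>\<sigma>\<bar> powr p"
    and "smooth_compact f" and "smooth_compact g"
    and "(LINT x|lebesgue. g x) > 0"
    and "Gamma_G N p \<ge> 0"
  shows "\<exists>\<epsilon>0 C. \<epsilon>0 > 0 \<and> C > 0 \<and>
    (\<forall>\<epsilon> T u. 0 < \<epsilon> \<and> \<epsilon> \<le> \<epsilon>0 \<and> weak_solution G f g \<epsilon> T u \<and>
        spacetime_supp T u \<subseteq> {(x, t). t \<in> {0..T} \<and> norm x \<le> r0 + t} \<longrightarrow>
      (ereal p < p_G N \<longrightarrow> T \<le> C * \<epsilon> powr (- inverse (Gamma_G N p))) \<and>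
      (N \<ge> 2 \<and> ereal p = p_G N \<longrightarrow> T \<le> exp (C * \<epsilon> powr (- (p - 1)))))"
proof -
  note p = \<open>1 < p\<close>
  have N: "N = DIM(real ^ 'n)" by (simp add: N_def)
  then have N1: "1 \<le> N" using DIM_positive[where 'a = "real ^ 'n"] by linarith
  have G: "continuous_on UNIV G"
    using \<open>G C1_differentiable_on UNIV\<close> by (rule C1_differentiable_imp_continuous_on)
  \<comment> \<open>The supremum is meaningful only over a nonempty bounded set; positivity of the
    integral of \<open>g\<close> supplies a point of its support.\<close>
  have r0: "0 \<le> r0"
  proof -
    obtain x where "g x \<noteq> 0"
    proof (rule ccontr)
      assume "\<not> thesis"
      then have "g x = 0" for x using that by blast
      then show False using \<open>0 < (LINT x|lebesgue. g x)\<close> by simp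
    qed
    then have "x \<in> supp g" using supp_vanish by blast
    moreover have "bdd_above (norm ` (supp f \<union> supp g))"
      using \<open>smooth_compact f\<close> \<open>smooth_compact g\<close>
      by (simp add: smooth_compact_def compact_imp_bounded bounded_imp_bdd_above bounded_norm_comp)
    ultimately have "norm x \<le> r0" unfolding r0_def by (intro cSup_upper) auto
    then show ?thesis by (rule order_trans[OF norm_ge_zero])
  qed
  \<comment> \<open>Half of the integral leaves strict slack for a positive frequency
    \<open>l\<close>. Both are fixed before \<open>\<epsilon>\<close> and the solution
    enter.\<close>
  define c0 where "c0 = (LINT x|lebesgue. g x) / 2"
  have c0: "0 < c0" "c0 < (LINT x|lebesgue. g x)"
    using \<open>0 < (LINT x|lebesgue. g x)\<close> by (simp_all add: c0_def)
  obtain e :: "real ^ 'n" where e: "e \<in> Basis" using nonempty_Basis by blast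
  obtain l where l: "0 < l"
    "c0 < (LINT x|lebesgue. (g x + l * f x) * exp (l * (x \<bullet> e)))"
    "c0 < (LINT x|lebesgue. (g x - l * f x) * exp (l * (x \<bullet> e)))"
    using low_frequency_data[OF \<open>smooth_compact f\<close> \<open>smooth_compact g\<close> c0(2) e] by blast
  define \<kappa> where "\<kappa> = (real N - 1) * (p - 1) / 2"
  have \<Gamma>: "Gamma_G N p = (1 - \<kappa>) / (p - 1)"
    using p by (simp add: Gamma_G_def \<kappa>_def field_simps)
  have \<kappa>: "\<kappa> \<le> 1" using \<open>Gamma_G N p \<ge> 0\<close> p unfolding \<Gamma> by (simp add: zero_le_divide_iff)
  define a where "a = (p - 1) * (b * wave_const N l r0 powr (1 - p) / 2)"
  have a: "0 < a" using p \<open>0 < b\<close> wave_const_pos[OF l(1) r0, of N] by (simp add: a_def)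
  \<comment> \<open>The constant collects everything except the factor
    \<open>\<epsilon> powr (1 - p)\<close>, split off from
    \<open>(\<epsilon> * c0 / 2) powr (1 - p)\<close>.\<close>
  define D where "D = (c0 / 2) powr (1 - p) / a"
  have D: "0 < D" using a c0 by (simp add: D_def)
  have bound: "integral {0..t} (\<lambda>s. (1 + s) powr (- \<kappa>)) \<le> D * \<epsilon> powr (1 - p)"
    if "0 < \<epsilon>" "weak_solution G f g \<epsilon> T u"
      "spacetime_supp T u \<subseteq> {(x, t). t \<in> {0..T} \<and> norm x \<le> r0 + t}" "0 \<le> t" "t < T" for \<epsilon> T u t
  proof -
    have "a * integral {0..t} (\<lambda>s. (1 + s) powr (- \<kappa>)) \<le> (\<epsilon> * c0 / 2) powr (1 - p)"
      unfolding a_def \<kappa>_def N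
      using weak_solution_lifespan_integral[OF p \<open>0 < b\<close> G assms(7) \<open>smooth_compact f\<close> \<open>smooth_compact g\<close> e l(1) r0
          that(1) c0(1) _ _ that(2-5)] l c0(1) by simp
    also have "\<dots> = (c0 / 2) powr (1 - p) * \<epsilon> powr (1 - p)"
      using that(1) c0 by (simp flip: powr_mult add: mult.commute)
    finally show ?thesis using a by (simp add: D_def field_simps)
  qed
  show ?thesis
  \<comment> \<open>\<open>\<kappa> = 1\<close> is precisely the critical case
    \<open>N \<ge> 2\<close>, \<open>p = p_G N\<close>. In either case one of the two implications
    is vacuous, and \<open>\<epsilon>0 = 1\<close> serves.\<close>
  proof (cases "\<kappa> = 1")
    case True
    then have "N \<noteq> 1" "(real N - 1) * (p - 1) = 2" by (auto simp: \<kappa>_def)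
    then have "ereal p = p_G N" using N1 by (simp add: p_G_def field_simps)
    then show ?thesis
      using D bound True lifespan_bound_critical by (intro exI[of _ 1] exI[of _ D]) auto
  next
    case False
    then have \<kappa>1: "\<kappa> < 1" using \<kappa> by simp
    have crit: "\<not> (2 \<le> N \<and> ereal p = p_G N)"
      using False p by (auto simp: p_G_def \<kappa>_def field_simps)
    have "inverse (Gamma_G N p) = (p - 1) / (1 - \<kappa>)" by (simp add: \<Gamma>)
    moreover have "0 < (1 + (1 - \<kappa>) * D) powr (1 / (1 - \<kappa>))"
      using add_pos_pos[of 1 "(1 - \<kappa>) * D"] D \<kappa>1 by simp
    ultimately show ?thesis
      using crit lifespan_bound_subcritical[OF p \<kappa>1 less_imp_le[OF D]] bound
      by (intro exI[of _ 1] exI[of _ "(1 + (1 - \<kappa>) * D) powr (1 / (1 - \<kappa>))"]) auto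
  qed
qed

end
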